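(* Let $q$ be a prime power, let $m\geq 4$ be even, and let $\eta$ be a non-degenerate Hermitian form on an $m$-dimensional vector space $V$ over $\mathbb{F}_{q^2}$. (i) If $m=4$ or $m=6$, then the minimum weight codewords of the line Hermitian Grassmann code defined by $\eta$ are exactly the codewords $c_\varphi$ corresponding to (non-singular) alternating bilinear forms $\varphi$ on $V$ which are permutable with $\eta$. (ii) If $m>6$, then the minimum weight codewords are exactly the codewords $c_\varphi$ corresponding to alternating bilinear forms $\varphi$ on $V$ with $\dim(\mathrm{Rad}(\varphi))=m-2$ and such that $[\mathrm{Rad}(\varphi)]$ meets $\mathcal{H}_m$ in a Hermitian cone of the form $[\Pi_2]\mathcal{H}_{m-4}$.
   Context: Hermitian forms are sesquilinear with respect to $x\mapsto x^q$. $\mathcal{H}_m$ is the set of points $[u]$ of $\mathrm{PG}(V)$ with $\eta(u,u)=0$. For an alternating bilinear form $\varphi$ on $V$, $\mathrm{Rad}(\varphi)=\{x\in V:\varphi(x,y)=0\ \forall y\in V\}$; $\perp_\eta$ and $\perp_\varphi$ denote orthogonality with respect to $\eta$ and $\varphi$. A non-singular alternating form $\varphi$ is permutable with $\eta$ if the polarities commute: $[u]^{\perp_\varphi\perp_\eta}=[u]^{\perp_\eta\perp_\varphi}$ for all points $[u]$ of $\mathrm{PG}(V)$. Saying that $[\mathrm{Rad}(\varphi)]\cap\mathcal{H}_m$ is of the form $[\Pi_t]\mathcal{H}_{s}$ (with $t+s=\dim\mathrm{Rad}(\varphi)$) means that the restriction of $\eta$ to $\mathrm{Rad}(\varphi)$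 has radical $\Pi_t$ of vector dimension exactly $t$. Line Hermitian Grassmann code: let $\Omega=\{[\omega_1],\dots,[\omega_N]\}$ be the set of points $[v_1\wedge v_2]$ of $\mathrm{PG}(\bigwedge^2V)$, where $\langle v_1,v_2\rangle$ ranges over the totally $\eta$-isotropic 2-dimensional subspaces of $V$; the codewords are $c_\varphi=(\varphi(\omega_1),\dots,\varphi(\omega_N))$, for $\varphi$ an alternating bilinear form on $V$ regarded as a linear functional on $\bigwedge^2V$ via $\varphi(v_1\wedge v_2)=\varphi(v_1,v_2)$. *)

theory Defs
  imports
    "HOL-Analysis.Analysis"
    "HOL-Library.Poly_Mapping"
    "HOL-Number_Theory.Prime_Powers"
begin

section \<open>Forms\<close>

definition alternating_form :: "('k::field ^ 'n \<Rightarrow> 'k ^ 'n \<Rightarrow> 'k) \<Rightarrow> bool" where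
  "alternating_form \<phi> \<longleftrightarrow>
     (\<forall>y. Vector_Spaces.linear (*s) (*) (\<lambda>x. \<phi> x y)) \<and>
     (\<forall>x. Vector_Spaces.linear (*s) (*) (\<phi> x)) \<and>
     (\<forall>x. \<phi> x x = 0)"

text \<open>Over a field with \<open>q\<^sup>2\<close> elements; the first argument is the linear one.
  Additivity and semilinearity in the second argument follow from the other clauses
  when \<open>x \<mapsto> x ^ q\<close> is a field automorphism.\<close>

definition hermitian_form :: "nat \<Rightarrow> ('k::field ^ 'n \<Rightarrow> 'k ^ 'n \<Rightarrow> 'k) \<Rightarrow> bool" where
  "hermitian_form q \<eta> \<longleftrightarrow>
     (\<forall>y. Vector_Spaces.linear (*s) (*) (\<lambda>x. \<eta> x y)) \<and>
     (\<forall>x y z. \<eta> x (y + z) = \<eta> x y + \<eta> x z) \<and>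
     (\<forall>a x y. \<eta> x (a *s y) = a ^ q * \<eta> x y) \<and>
     (\<forall>x y. \<eta> y x = \<eta> x y ^ q)"

text \<open>The forms considered are alternating or Hermitian, hence reflexive, so that left and
  right radicals and orthogonal spaces coincide.\<close>

definition radical_on :: "('k::field ^ 'n) set \<Rightarrow> ('k ^ 'n \<Rightarrow> 'k ^ 'n \<Rightarrow> 'k) \<Rightarrow> ('k ^ 'n) set" where
  "radical_on U \<beta> = {x \<in> U. \<forall>y \<in> U. \<beta> x y = 0}"

abbreviation radical :: "('k::field ^ 'n \<Rightarrow> 'k ^ 'n \<Rightarrow> 'k) \<Rightarrow> ('k ^ 'n) set" where
  "radical \<equiv> radical_on UNIV"

definition nondegenerate :: "('k::field ^ 'n \<Rightarrow> 'k ^ 'n \<Rightarrow> 'k) \<Rightarrow> bool" where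
  "nondegenerate \<beta> \<longleftrightarrow> radical \<beta> = {0}"

definition orth :: "('k::field ^ 'n \<Rightarrow> 'k ^ 'n \<Rightarrow> 'k) \<Rightarrow> ('k ^ 'n) set \<Rightarrow> ('k ^ 'n) set" where
  "orth \<beta> S = {y. \<forall>x \<in> S. \<beta> x y = 0}"

text \<open>The polarities commute on the points \<open>[u]\<close>; meant for non-degenerate forms.\<close>

definition permutable :: "('k::field ^ 'n::finite \<Rightarrow> 'k ^ 'n \<Rightarrow> 'k) \<Rightarrow> ('k ^ 'n \<Rightarrow> 'k ^ 'n \<Rightarrow> 'k) \<Rightarrow> bool" where
  "permutable \<phi> \<eta> \<longleftrightarrow>
     (\<forall>u. u \<noteq> 0 \<longrightarrow> orth \<eta> (orth \<phi> (vec.span {u})) = orth \<phi> (orth \<eta> (vec.span {u})))"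

text \<open>The projective space \<open>[U]\<close> meets the Hermitian variety of \<open>\<eta>\<close> in a cone
  \<open>[\<Pi>\<^sub>t]\<H>\<^sub>s\<close> whose vertex is \<open>[\<Pi>\<^sub>t]\<close>, with \<open>t\<close> the vector dimension of \<open>\<Pi>\<^sub>t\<close>.\<close>

definition meets_in_cone ::
  "('k::field ^ 'n::finite \<Rightarrow> 'k ^ 'n \<Rightarrow> 'k) \<Rightarrow> ('k ^ 'n) set \<Rightarrow> nat \<Rightarrow> nat \<Rightarrow> bool" where
  "meets_in_cone \<eta> U t s \<longleftrightarrow> vec.dim U = t + s \<and> vec.dim (radical_on U \<eta>) = t"

definition totally_isotropic :: "('k::field ^ 'n \<Rightarrow> 'k ^ 'n \<Rightarrow> 'k) \<Rightarrow> ('k ^ 'n) set \<Rightarrow> bool" where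
  "totally_isotropic \<eta> U \<longleftrightarrow> (\<forall>x \<in> U. \<forall>y \<in> U. \<eta> x y = 0)"


section \<open>The exterior square\<close>

text \<open>\<open>\<And>\<^sup>2V\<close> is the free vector space on \<open>V \<times> V\<close> modulo the relations making
  \<open>(u, v) \<mapsto> u \<and> v\<close> bilinear and alternating.\<close>

definition free_scale :: "'k::field \<Rightarrow> ('b \<Rightarrow>\<^sub>0 'k) \<Rightarrow> ('b \<Rightarrow>\<^sub>0 'k)" where
  "free_scale a p = Poly_Mapping.map (\<lambda>b. a * b) p"

lemma lookup_free_scale [simp]: "Poly_Mapping.lookup (free_scale a p) x = a * Poly_Mapping.lookup p x"
  by (simp add: free_scale_def map.rep_eq when_def)

interpretation free: vector_space free_scale
  by unfold_locales (auto intro!: poly_mapping_eqI simp: lookup_add algebra_simps)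

abbreviation gen :: "'b \<Rightarrow> 'b \<Rightarrow> ('b \<times> 'b) \<Rightarrow>\<^sub>0 'k::field" where
  "gen u v \<equiv> Poly_Mapping.single (u, v) 1"

definition ext2_relators :: "(('k::field ^ 'n) \<times> ('k ^ 'n) \<Rightarrow>\<^sub>0 'k) set" where
  "ext2_relators =
     {gen (u + v) w - gen u w - gen v w |u v w. True} \<union>
     {gen w (u + v) - gen w u - gen w v |u v w. True} \<union>
     {gen (a *s u) v - free_scale a (gen u v) |a u v. True} \<union>
     {gen u (a *s v) - free_scale a (gen u v) |a u v. True} \<union>
     {gen u u |u. True}"

definition ext2_eq ::
  "(('k::field ^ 'n) \<times> ('k ^ 'n) \<Rightarrow>\<^sub>0 'k) \<Rightarrow> (('k ^ 'n) \<times> ('k ^ 'n) \<Rightarrow>\<^sub>0 'k) \<Rightarrow> bool" where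
  "ext2_eq p p' \<longleftrightarrow> p - p' \<in> free.span ext2_relators"

quotient_type (overloaded) ('k, 'n) ext2 =
  "('k::field ^ 'n::finite) \<times> ('k ^ 'n) \<Rightarrow>\<^sub>0 'k" / ext2_eq
proof (rule equivpI)
  show "reflp ext2_eq"
    by (simp add: reflp_def ext2_eq_def free.span_zero)
  show "symp ext2_eq"
    unfolding symp_def ext2_eq_def by (auto dest: free.span_neg)
  show "transp ext2_eq"
    unfolding transp_def ext2_eq_def by (auto dest: free.span_add)
qed

instantiation ext2 :: (field, finite) ab_group_add
begin

lift_definition zero_ext2 :: "('a, 'b) ext2" is 0 .

lift_definition plus_ext2 :: "('a, 'b) ext2 \<Rightarrow> ('a, 'b) ext2 \<Rightarrow> ('a, 'b) ext2" is "(+)"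
  unfolding ext2_eq_def by (drule (1) free.span_add) (simp add: algebra_simps)

lift_definition uminus_ext2 :: "('a, 'b) ext2 \<Rightarrow> ('a, 'b) ext2" is uminus
  unfolding ext2_eq_def by (drule free.span_neg) (simp add: algebra_simps)

lift_definition minus_ext2 :: "('a, 'b) ext2 \<Rightarrow> ('a, 'b) ext2 \<Rightarrow> ('a, 'b) ext2" is "(-)"
  unfolding ext2_eq_def by (drule (1) free.span_diff) (simp add: algebra_simps)

instance
  by standard (transfer; simp add: ext2_eq_def free.span_zero algebra_simps)+

end

lift_definition ext2_scale :: "'k::field \<Rightarrow> ('k, 'n::finite) ext2 \<Rightarrow> ('k, 'n) ext2"
  is free_scale
  unfolding ext2_eq_def by (drule free.span_scale) (simp add: free.scale_right_diff_distrib)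

interpretation ext2: vector_space ext2_scale
  by unfold_locales
    (transfer; simp add: ext2_eq_def free.span_zero free.scale_right_distrib free.scale_left_distrib)+

lift_definition wedge :: "'k::field ^ 'n::finite \<Rightarrow> 'k ^ 'n \<Rightarrow> ('k, 'n) ext2" is gen .

definition ext2_functional ::
  "('k::field ^ 'n::finite \<Rightarrow> 'k ^ 'n \<Rightarrow> 'k) \<Rightarrow> ('k, 'n) ext2 \<Rightarrow> 'k" where
  "ext2_functional \<phi> =
     (THE f. Vector_Spaces.linear ext2_scale (*) f \<and> (\<forall>u v. f (wedge u v) = \<phi> u v))"

lemma poly_mapping_in_span_single: "p \<in> free.span (range (\<lambda>x. Poly_Mapping.single x 1))"
proof -
  let ?s = "\<Sum>x\<in>Poly_Mapping.keys p. free_scale (Poly_Mapping.lookup p x) (Poly_Mapping.single x 1)"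
  have "Poly_Mapping.lookup ?s k = Poly_Mapping.lookup p k" for k
    by (simp add: lookup_sum lookup_single when_def if_distrib[where f = "(*) _"] in_keys_iff
        cong: if_cong)
  then have "?s = p"
    by (rule poly_mapping_eqI)
  moreover have "?s \<in> free.span (range (\<lambda>x. Poly_Mapping.single x 1))"
    by (intro free.span_sum free.span_scale free.span_base rangeI)
  ultimately show ?thesis
    by simp
qed

lemma span_wedge: "ext2.span {wedge u v |u v. True} = UNIV"
proof -
  have "abs_ext2 p \<in> ext2.span {wedge u v |u v. True}" for p
    using poly_mapping_in_span_single[of p]
  proof (induction rule: free.span_induct_alt)
    case base
    then show ?case by (simp add: ext2.span_zero flip: zero_ext2.abs_eq)
  next
    case (step c x y)
    then obtain u v where "x = gen u v" by force
    then have "abs_ext2 (free_scale c x + y) = ext2_scale c (wedge u v) + abs_ext2 y"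
      by (simp add: wedge.abs_eq ext2_scale.abs_eq plus_ext2.abs_eq)
    moreover have "wedge u v \<in> {wedge u v |u v. True}"
      by blast
    ultimately show ?case
      using step(2) by (metis (no_types, lifting) ext2.span_add ext2.span_scale ext2.span_base)
  qed
  then have "\<omega> \<in> ext2.span {wedge u v |u v. True}" for \<omega> :: "('a, 'b) ext2"
    by (induct \<omega> rule: ext2.abs_induct)
  then show ?thesis
    by blast
qed

definition free_lift :: "('b \<Rightarrow> 'k::field) \<Rightarrow> ('b \<Rightarrow>\<^sub>0 'k) \<Rightarrow> 'k" where
  "free_lift f p = (\<Sum>x\<in>Poly_Mapping.keys p. Poly_Mapping.lookup p x * f x)"

lemma free_lift_superset:
  "finite A \<Longrightarrow> Poly_Mapping.keys p \<subseteq> A \<Longrightarrow> free_lift f p = (\<Sum>x\<in>A. Poly_Mapping.lookup p x * f x)"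
  unfolding free_lift_def by (rule sum.mono_neutral_left) (auto simp: in_keys_iff)

lemma linear_free_lift: "Vector_Spaces.linear free_scale (*) (free_lift f)"
proof -
  have "free_lift f (p + p') = free_lift f p + free_lift f p'" for p p'
    using free_lift_superset[of "Poly_Mapping.keys p \<union> Poly_Mapping.keys p'" "p + p'" f]
      free_lift_superset[of "Poly_Mapping.keys p \<union> Poly_Mapping.keys p'" p f]
      free_lift_superset[of "Poly_Mapping.keys p \<union> Poly_Mapping.keys p'" p' f]
    by (simp add: keys_add lookup_add distrib_right sum.distrib)
  moreover have "free_lift f (free_scale a p) = a * free_lift f p" for a p
    using free_lift_superset[of "Poly_Mapping.keys p" "free_scale a p" f]
    by (auto simp: in_keys_iff free_lift_def sum_distrib_left mult.assoc subset_iff)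
  ultimately show ?thesis
    by unfold_locales auto
qed

lemma free_lift_single [simp]: "free_lift f (Poly_Mapping.single x 1) = f x"
  by (simp add: free_lift_def)

theorem ex1_ext2_functional:
  assumes "alternating_form \<phi>"
  shows "\<exists>!f. Vector_Spaces.linear ext2_scale (*) f \<and> (\<forall>u v. f (wedge u v) = \<phi> u v)"
proof -
  let ?L = "free_lift (case_prod \<phi>)"
  interpret L: Vector_Spaces.linear free_scale "(*)" ?L
    by (rule linear_free_lift)
  have add1: "\<phi> (u + v) w = \<phi> u w + \<phi> v w" and scale1: "\<phi> (a *s u) v = a * \<phi> u v"
    and add2: "\<phi> w (u + v) = \<phi> w u + \<phi> w v" and scale2: "\<phi> u (a *s v) = a * \<phi> u v"
    and alt: "\<phi> u u = 0" for u v w a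
    using assms unfolding alternating_form_def Vector_Spaces.linear_iff by auto
  have "?L p = 0" if "p \<in> free.span ext2_relators" for p
    using that
  proof (induction rule: free.span_induct_alt)
    case base
    then show ?case by (rule L.zero)
  next
    case (step c x y)
    then have "?L x = 0"
      by (auto simp: ext2_relators_def L.diff L.scale add1 add2 scale1 scale2 alt)
    with step show ?case by (simp add: L.add L.scale)
  qed
  then have resp: "?L p = ?L p'" if "ext2_eq p p'" for p p'
  proof -
    have "?L p - ?L p' = 0"
      using that \<open>\<And>p. p \<in> free.span ext2_relators \<Longrightarrow> ?L p = 0\<close>[of "p - p'"]
      by (simp add: ext2_eq_def L.diff)
    then show ?thesis
      by simp
  qed
  define F where "F \<omega> = ?L (rep_ext2 \<omega>)" for \<omega>
  have F: "F (abs_ext2 p) = ?L p" for p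
    unfolding F_def by (rule resp) (intro Quotient3_rep_abs[OF Quotient3_ext2] equivp_reflp[OF ext2_equivp])
  have abs: "\<exists>p. \<omega> = abs_ext2 p" for \<omega> :: "('a, 'b) ext2"
    by (induct \<omega> rule: ext2.abs_induct) blast
  have "F (\<omega> + \<omega>') = F \<omega> + F \<omega>'" "F (ext2_scale a \<omega>) = a * F \<omega>" for \<omega> \<omega>' a
    using abs[of \<omega>] abs[of \<omega>'] by (auto simp: plus_ext2.abs_eq ext2_scale.abs_eq F L.add L.scale)
  then have linF: "Vector_Spaces.linear ext2_scale (*) F"
    by unfold_locales auto
  have wedgeF: "F (wedge u v) = \<phi> u v" for u v
    by (simp add: wedge.abs_eq F)
  show ?thesis
  proof (rule ex1I[of _ F])
    show "Vector_Spaces.linear ext2_scale (*) F \<and> (\<forall>u v. F (wedge u v) = \<phi> u v)"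
      using linF wedgeF by blast
  next
    fix f
    assume f: "Vector_Spaces.linear ext2_scale (*) f \<and> (\<forall>u v. f (wedge u v) = \<phi> u v)"
    interpret vector_space_pair ext2_scale "(*) :: 'a \<Rightarrow> 'a \<Rightarrow> 'a" ..
    show "f = F"
    proof
      fix \<omega>
      show "f \<omega> = F \<omega>"
        by (rule linear_eq_on[of f F \<omega> "{wedge u v |u v. True}"])
          (use f linF wedgeF span_wedge in auto)
    qed
  qed
qed

lemma
  assumes "alternating_form \<phi>"
  shows linear_ext2_functional: "Vector_Spaces.linear ext2_scale (*) (ext2_functional \<phi>)"
    and ext2_functional_wedge: "ext2_functional \<phi> (wedge u v) = \<phi> u v"
  using theI'[OF ex1_ext2_functional[OF assms]] unfolding ext2_functional_def by auto


section \<open>Line Hermitian Grassmann codes\<close>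

definition line_hermitian_grassmannian ::
  "('k::field ^ 'n::finite \<Rightarrow> 'k ^ 'n \<Rightarrow> 'k) \<Rightarrow> ('k, 'n) ext2 set set" where
  "line_hermitian_grassmannian \<eta> =
     {ext2.span {wedge v w} |v w.
        vec.dim (vec.span {v, w}) = 2 \<and> totally_isotropic \<eta> (vec.span {v, w})}"

text \<open>The list \<open>\<omega>s\<close> fixes an ordering of a set of points and a representative of each point.\<close>

definition point_representatives :: "('k::field, 'n::finite) ext2 list \<Rightarrow> ('k, 'n) ext2 set set \<Rightarrow> bool" where
  "point_representatives \<omega>s \<Omega> \<longleftrightarrow>
     distinct (map (\<lambda>\<omega>. ext2.span {\<omega>}) \<omega>s) \<and> set (map (\<lambda>\<omega>. ext2.span {\<omega>}) \<omega>s) = \<Omega>"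

definition codeword ::
  "('k::field, 'n::finite) ext2 list \<Rightarrow> ('k ^ 'n \<Rightarrow> 'k ^ 'n \<Rightarrow> 'k) \<Rightarrow> 'k list" where
  "codeword \<omega>s \<phi> = map (ext2_functional \<phi>) \<omega>s"

definition grassmann_code :: "('k::field, 'n::finite) ext2 list \<Rightarrow> 'k list set" where
  "grassmann_code \<omega>s = {codeword \<omega>s \<phi> |\<phi>. alternating_form \<phi>}"

definition hamming_weight :: "'k::zero list \<Rightarrow> nat" where
  "hamming_weight c = card {i. i < length c \<and> c ! i \<noteq> 0}"

text \<open>As usual for linear codes, the zero word is disregarded.\<close>

definition min_weight_codewords :: "'k::zero list set \<Rightarrow> 'k list set" where
  "min_weight_codewords C =
     {c. is_arg_min hamming_weight (\<lambda>c. c \<in> C \<and> c \<noteq> replicate (length c) 0) c}"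

end

theory Submission
  imports Defs
begin

text \<open>Write \<open>\<phi>(y, u) = \<eta>(y, f u)\<close> with a semilinear map \<open>f\<close> (called \<open>adj\<close>). Counting the ordered pairs
  \<open>(u, v)\<close> that span a totally isotropic line with \<open>\<phi>(v, u) \<noteq> 0\<close> one vector \<open>u\<close> at a time amounts to
  comparing the numbers of isotropic vectors in \<open>u\<^sup>\<bottom>\<close> and \<open>\<langle>u, f u\<rangle>\<^sup>\<bottom>\<close>. The result only depends on whether
  \<open>f u \<in> \<langle>u\<rangle>\<close> and whether \<open>f u\<close> is isotropic, and the weight is
  \<open>q\<^bsup>2m-4\<^esup> (I - E) + q\<^bsup>m-1\<^esup> D\<close> up to a constant factor, where \<open>I\<close> is the number of isotropic vectors,
  \<open>E\<close> the number of those with \<open>f u \<in> \<langle>u\<rangle>\<close>, and \<open>D\<close> the number of those with \<open>f u\<close> non-isotropic.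
  So the minimum weight forms maximise \<open>E\<close>, which is the number of isotropic vectors of the radical
  plus the number of eigenvectors of \<open>f\<close>. The latter dominates for \<open>m \<le> 6\<close>, with the maximum
  attained exactly when \<open>f\<^sup>2\<close> is a scalar, that is, when the polarities commute; the former dominates
  for \<open>m > 6\<close>, where a radical of codimension 2 that contains its own orthogonal space is optimal.
  In both cases \<open>D = 0\<close> for the maximisers.\<close>

section \<open>Subspaces over a finite field\<close>

text \<open>Each vector of the larger span is uniquely a multiple of \<open>b\<close> plus an
  element of the old span, so each basis vector contributes one factor
  \<open>CARD('k)\<close>.\<close>

lemma card_span_independent:
  fixes B :: "('k::{field,finite} ^ 'n::finite) set"
  assumes "finite B" "vec.independent B"
  shows "card (vec.span B) = CARD('k) ^ card B"
  using assms
proof (induction B rule: finite_induct)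
  case empty
  then show ?case by simp
next
  case (insert b B)
  then have indep: "vec.independent B" and b: "b \<notin> vec.span B"
    by (auto simp: vec.independent_insert)
  let ?g = "\<lambda>(a, y). a *s b + y"
  have "vec.span (insert b B) = ?g ` (UNIV \<times> vec.span B)"
  proof
    show "vec.span (insert b B) \<subseteq> ?g ` (UNIV \<times> vec.span B)"
    proof
      fix x assume "x \<in> vec.span (insert b B)"
      then obtain k where "x - k *s b \<in> vec.span B"
        by (auto simp: vec.span_insert)
      then show "x \<in> ?g ` (UNIV \<times> vec.span B)"
        by (intro image_eqI[of _ _ "(k, x - k *s b)"]) auto
    qed
    show "?g ` (UNIV \<times> vec.span B) \<subseteq> vec.span (insert b B)"
      by (auto simp: vec.span_insert) (metis add_diff_cancel_left')
  qed
  moreover have "inj_on ?g (UNIV \<times> vec.span B)"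
  proof (rule inj_onI, clarsimp)
    fix a y a' y'
    assume y: "y \<in> vec.span B" "y' \<in> vec.span B" and eq: "a *s b + y = a' *s b + y'"
    have d: "(a - a') *s b = y' - y"
      using eq by (simp add: vec.scale_left_diff_distrib algebra_simps)
    have "a = a'"
    proof (rule ccontr)
      assume "a \<noteq> a'"
      moreover have "(a - a') *s b \<in> vec.span B"
        unfolding d using y by (rule_tac vec.span_diff)
      ultimately show False
        using b vec.span_scale[of "(a - a') *s b" B "inverse (a - a')"]
        by (simp del: vec.scale_left_diff_distrib vector_sub_rdistrib)
    qed
    with d show "a = a' \<and> y = y'"
      by auto
  qed
  ultimately show ?case
    using insert indep by (simp add: card_image card_cartesian_product)
qed

lemma card_subspace:
  fixes U :: "('k::{field,finite} ^ 'n::finite) set"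
  assumes "vec.subspace U"
  shows "card U = CARD('k) ^ vec.dim U"
proof -
  obtain B where B: "B \<subseteq> U" "vec.independent B" "U \<subseteq> vec.span B" "card B = vec.dim U"
    using vec.basis_exists[of U] by metis
  then have "vec.span B = U"
    using assms by (metis vec.span_subspace)
  with B card_span_independent[of B] show ?thesis
    by simp
qed

lemma int_card_Diff_subset:
  assumes "finite A" "B \<subseteq> A"
  shows "int (card (A - B)) = int (card A) - int (card B)"
  using assms card_mono[OF assms] by (simp add: card_Diff_subset finite_subset of_nat_diff)

lemma card_field_gt_1: "1 < CARD('k::{field,finite})"
proof -
  have "card {0, 1 :: 'k} \<le> CARD('k)"
    by (rule card_mono) auto
  then show ?thesis by simp
qed

lemma dim_le_card_vec: "vec.dim (U :: ('k::field ^ 'n::finite) set) \<le> CARD('n)"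
  by (metis vec.dim_subset subset_UNIV vec_dim_card)

text \<open>The sum is direct, so addition is injective on \<open>U \<times> W\<close>. Comparing
  cardinalities, which are powers of the field order, gives the bound on dimensions.\<close>

lemma dim_add_le_of_Int_trivial:
  fixes U W :: "('k::{field,finite} ^ 'n::finite) set"
  assumes "vec.subspace U" "vec.subspace W" "U \<inter> W \<subseteq> {0}"
  shows "vec.dim U + vec.dim W \<le> CARD('n)"
proof -
  have "inj_on (\<lambda>(u, w). u + w) (U \<times> W)"
  proof (rule inj_onI, clarsimp)
    fix u w u' w'
    assume *: "u \<in> U" "w \<in> W" "u' \<in> U" "w' \<in> W" "u + w = u' + w'"
    have "u - u' = w' - w"
      using *(5) by (simp add: algebra_simps)
    moreover have "u - u' \<in> U" "w' - w \<in> W"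
      using * assms by (auto intro: vec.subspace_diff)
    ultimately have "u - u' = 0"
      using assms(3) by auto
    then show "u = u' \<and> w = w'"
      using *(5) by auto
  qed
  then have "card (U \<times> W) \<le> CARD('k ^ 'n)"
    by (metis card_image card_mono finite subset_UNIV)
  then have "CARD('k) ^ (vec.dim U + vec.dim W) \<le> CARD('k) ^ CARD('n)"
    using assms by (simp add: card_cartesian_product card_subspace power_add)
  then show ?thesis
    using card_field_gt_1[where 'k='k] by (simp only: power_increasing_iff)
qed

text \<open>\<open>x\<close> spans a complement of the kernel in \<open>U\<close>: subtracting a
  suitable multiple of \<open>x\<close> moves any vector of \<open>U\<close> into the
  kernel.\<close>

lemma dim_hyperplane_section:
  fixes U :: "('k::field ^ 'n::finite) set"
  assumes U: "vec.subspace U" and g: "Vector_Spaces.linear (*s) (*) g"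
    and x: "x \<in> U" "g x \<noteq> 0"
  shows "vec.dim {y \<in> U. g y = 0} + 1 = vec.dim U"
proof -
  interpret g: Vector_Spaces.linear "(*s)" "(*)" g by (rule g)
  let ?H = "{y \<in> U. g y = 0}"
  have H: "vec.subspace ?H"
    using U by (auto simp: vec.subspace_def g.add g.scale g.zero)
  have "x \<notin> vec.span ?H"
    using H x by (simp add: vec.span_eq_iff[THEN iffD2])
  then have "vec.dim (insert x ?H) = vec.dim ?H + 1"
    by (simp add: vec.dim_insert)
  moreover have "vec.span (insert x ?H) = vec.span U"
  proof
    show "vec.span (insert x ?H) \<subseteq> vec.span U"
      using x by (intro vec.span_mono) auto
    have "y \<in> vec.span (insert x ?H)" if "y \<in> U" for y
    proof -
      have "y - (g y / g x) *s x \<in> ?H"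
        using that x U by (auto simp: g.diff g.scale intro: vec.subspace_diff vec.subspace_scale)
      then show ?thesis
        by (auto simp: vec.span_insert intro: vec.span_base)
    qed
    then show "vec.span U \<subseteq> vec.span (insert x ?H)"
      by (intro vec.span_minimal) auto
  qed
  ultimately show ?thesis
    by (metis vec.dim_span)
qed

lemma dim_span_pair:
  "vec.dim (vec.span {u, v}) = (if u = 0 then if v = 0 then 0 else 1 else if v \<in> vec.span {u} then 1 else 2)"
  for u v :: "'k::field ^ 'n::finite"
  unfolding vec.dim_span
  by (subst insert_commute) (auto simp: vec.dim_insert vec.span_zero)

lemma in_span_pair: "x \<in> vec.span {u, v} \<longleftrightarrow> (\<exists>a b. x = a *s u + b *s v)"
  for u v :: "'k::field ^ 'n::finite"
proof
  assume "x \<in> vec.span {u, v}"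
  then obtain a b where "x - a *s u = b *s v"
    by (auto simp: vec.span_insert[of u] vec.span_singleton)
  then show "\<exists>a b. x = a *s u + b *s v"
    by (metis add.commute diff_add_cancel)
next
  assume "\<exists>a b. x = a *s u + b *s v"
  then show "x \<in> vec.span {u, v}"
    by (elim exE) (auto intro: vec.span_add vec.span_scale vec.span_base)
qed

lemma in_span_singleton: "x \<in> vec.span {u} \<longleftrightarrow> (\<exists>a. x = a *s u)"
  for u :: "'k::field ^ 'n::finite"
  by (auto simp: vec.span_singleton)

lemma card_power_eq_le:
  fixes c :: "'k::field"
  assumes "n > 0"
  shows "card {a. a ^ n = c} \<le> n"
proof -
  let ?p = "monom 1 n + [:- c:]"
  have "degree ?p = n"
    using assms by (subst degree_add_eq_left) (auto simp: degree_monom_eq)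
  moreover from this have "?p \<noteq> 0"
    using assms by (metis degree_0 less_irrefl)
  ultimately show ?thesis
    using card_poly_roots_bound[of ?p] by (simp add: poly_monom)
qed

section \<open>Conjugation and norm of the quadratic extension\<close>

locale hermitian_space =
  fixes q :: nat and \<eta> :: "'k::{field,finite} ^ 'n::finite \<Rightarrow> 'k ^ 'n \<Rightarrow> 'k"
  assumes card_k: "CARD('k) = q ^ 2"
    and hermitian: "hermitian_form q \<eta>"
    and nondeg: "nondegenerate \<eta>"
begin

lemma linear_left: "Vector_Spaces.linear (*s) (*) (\<lambda>x. \<eta> x y)"
  using hermitian unfolding hermitian_form_def by blast

lemma add_left [simp]: "\<eta> (x + y) z = \<eta> x z + \<eta> y z"
  and scale_left [simp]: "\<eta> (a *s x) z = a * \<eta> x z"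
  using linear_left[of z] unfolding Vector_Spaces.linear_iff by auto

lemma add_right [simp]: "\<eta> x (y + z) = \<eta> x y + \<eta> x z"
  and scale_right [simp]: "\<eta> x (a *s y) = a ^ q * \<eta> x y"
  and conj: "\<eta> y x = \<eta> x y ^ q"
  using hermitian unfolding hermitian_form_def by blast+

lemma q_gt_1: "1 < q"
proof (rule ccontr)
  assume "\<not> 1 < q"
  then have "q = 0 \<or> q = 1" by auto
  then show False
    using card_field_gt_1[where 'k='k] card_k by auto
qed

lemma zero_left [simp]: "\<eta> 0 y = 0" and zero_right [simp]: "\<eta> x 0 = 0"
  using scale_left[of 0 0 y] scale_right[of x 0 0] q_gt_1 by (auto simp: zero_power)

lemma sum_left: "\<eta> (sum g A) y = (\<Sum>i\<in>A. \<eta> (g i) y)"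
  by (induction A rule: infinite_finite_induct) auto

lemma sum_right: "\<eta> y (sum g A) = (\<Sum>i\<in>A. \<eta> y (g i))"
  by (induction A rule: infinite_finite_induct) auto

lemma nondegD: "(\<And>y. \<eta> x y = 0) \<Longrightarrow> x = 0"
  using nondeg by (auto simp: nondegenerate_def radical_on_def)

lemma sym_zero: "\<eta> x y = 0 \<longleftrightarrow> \<eta> y x = 0"
  using conj[of x y] conj[of y x] q_gt_1 by auto

text \<open>A pair with value 1 lets scalars be read off from \<open>\<eta>\<close>; this is how
  \<open>x ^ q\<close> is shown below to be additive and involutive.\<close>

lemma ex_form_eq_1: "\<exists>x y. \<eta> x y = 1"
proof -
  have "axis (undefined :: 'n) (1 :: 'k) \<noteq> 0"
    by (simp add: axis_eq_0_iff)
  then obtain y where y: "\<eta> (axis undefined 1) y \<noteq> 0"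
    using nondegD by blast
  then have "\<eta> (inverse (\<eta> (axis undefined 1) y) *s axis undefined 1) y = 1"
    by simp
  then show ?thesis by blast
qed

lemma frob_add: "(a + b) ^ q = a ^ q + b ^ q" for a b :: 'k
proof -
  obtain x y where xy: "\<eta> x y = 1"
    using ex_form_eq_1 by blast
  have "\<eta> y (a *s x + b *s x) = (a + b) ^ q"
    using conj[of y "a *s x + b *s x"] xy by simp
  moreover have "\<eta> y (a *s x + b *s x) = a ^ q + b ^ q"
    using conj[of y x] xy by simp
  ultimately show ?thesis by simp
qed

lemma frob_frob [simp]: "(a ^ q) ^ q = a" for a :: 'k
proof -
  obtain x y where xy: "\<eta> x y = 1"
    using ex_form_eq_1 by blast
  then have "\<eta> (a *s x) y = a"
    by simp
  then show ?thesis
    using conj[of "a *s x" y] conj[of y "a *s x"] by metis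
qed

lemma frob_zero [simp]: "(0::'k) ^ q = 0"
  using q_gt_1 by simp

lemma frob_minus [simp]: "(- a) ^ q = - (a ^ q)" for a :: 'k
  using frob_add[of a "- a"] q_gt_1 by (simp add: eq_neg_iff_add_eq_0 add.commute)

lemma diff_left [simp]: "\<eta> (x - y) z = \<eta> x z - \<eta> y z"
  using add_left[of "x - y" y z] by (simp del: add_left)

lemma diff_right [simp]: "\<eta> z (x - y) = \<eta> z x - \<eta> z y"
  using add_right[of z "x - y" y] by (simp del: add_right)

lemma minus_right [simp]: "\<eta> z (- x) = - \<eta> z x"
  using diff_right[of z 0 x] by (simp del: diff_right)

lemma norm_in_fixed: "(a ^ (q + 1)) ^ q = a ^ (q + 1)" for a :: 'k
  by (simp add: power_mult_distrib mult.commute)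

text \<open>The \<open>q ^ 2 - 1\<close> nonzero scalars are spread over at most
  \<open>q - 1\<close> norms, the roots of \<open>c ^ (q - 1) = 1\<close>, and each fibre has at
  most \<open>q + 1\<close> elements. Hence all these bounds are attained.\<close>

lemma card_norm_fibre:
  fixes c :: 'k
  assumes "c \<noteq> 0" "c ^ q = c"
  shows "card {a. a ^ (q + 1) = c} = q + 1"
proof -
  let ?B = "{c :: 'k. c ^ (q - 1) = 1}"
  let ?fib = "\<lambda>c. {a :: 'k. a ^ (q + 1) = c}"
  have cB: "card ?B \<le> q - 1"
    by (rule card_power_eq_le) (use q_gt_1 in auto)
  have fib: "card (?fib c) \<le> q + 1" for c
    by (rule card_power_eq_le) auto
  have inB: "c \<in> ?B" if "c \<noteq> 0" "c ^ q = c" for c :: 'k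
    using that q_gt_1 by (simp add: power_eq_if)
  have U: "UNIV - {0 :: 'k} \<subseteq> (\<Union>b\<in>?B. ?fib b)"
  proof
    fix x :: 'k assume "x \<in> UNIV - {0}"
    then have "x ^ (q + 1) \<in> ?B"
      by (intro inB norm_in_fixed) simp
    then show "x \<in> (\<Union>b\<in>?B. ?fib b)"
      by blast
  qed
  have "q ^ 2 - 1 = card (UNIV - {0 :: 'k})"
    by (simp add: card_k card_Diff_singleton)
  also have "\<dots> \<le> card (\<Union>b\<in>?B. ?fib b)"
    by (rule card_mono) (use U in auto)
  also have "\<dots> \<le> (\<Sum>b\<in>?B. card (?fib b))"
    by (rule card_UN_le) auto
  finally have le: "q ^ 2 - 1 \<le> (\<Sum>b\<in>?B. card (?fib b))" .
  show ?thesis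
  proof (rule ccontr)
    assume "card (?fib c) \<noteq> q + 1"
    with fib[of c] have "card (?fib c) < q + 1" by simp
    then have "(\<Sum>b\<in>?B. card (?fib b)) < (\<Sum>b\<in>?B. q + 1)"
      using inB[OF assms] fib by (intro sum_strict_mono_ex1) auto
    also have "\<dots> \<le> (q - 1) * (q + 1)"
      using cB unfolding sum_constant by (metis mult_le_mono1 of_nat_id)
    also have "\<dots> = q ^ 2 - 1"
      by (simp add: power2_eq_square algebra_simps)
    finally show False
      using le by simp
  qed
qed

lemma norm_surj: "c ^ q = c \<Longrightarrow> \<exists>a. a ^ (q + 1) = c" for c :: 'k
proof (cases "c = 0")
  case False
  assume "c ^ q = c"
  then have "{a. a ^ (q + 1) = c} \<noteq> {}"
    using card_norm_fibre[OF False] by (metis card.empty add_is_0 one_neq_zero)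
  then show ?thesis by blast
qed (auto intro: exI[of _ 0])

text \<open>Sorting the nonzero scalars by norm gives fibres of size \<open>q + 1\<close>, hence
  \<open>q - 1\<close> nonzero fixed scalars; zero is the remaining one.\<close>

lemma card_fixed: "card {c :: 'k. c ^ q = c} = q"
proof -
  let ?B = "{c :: 'k. c \<noteq> 0 \<and> c ^ q = c}"
  have "UNIV - {0 :: 'k} = (\<Union>b\<in>?B. {a. a ^ (q + 1) = b})"
    using norm_in_fixed by auto
  then have "card (UNIV - {0 :: 'k}) = (\<Sum>b\<in>?B. card {a :: 'k. a ^ (q + 1) = b})"
    by (simp, subst card_UN_disjoint) auto
  also have "\<dots> = (\<Sum>b\<in>?B. q + 1)"
    by (intro sum.cong refl card_norm_fibre) auto
  finally have "q ^ 2 - 1 = card ?B * (q + 1)"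
    by (simp add: card_k card_Diff_singleton)
  moreover have "q ^ 2 - 1 = (q - 1) * (q + 1)"
    by (simp add: power2_eq_square algebra_simps)
  ultimately have "card ?B = q - 1"
    by (metis mult_cancel2 add_is_0 one_neq_zero)
  moreover have "{c :: 'k. c ^ q = c} = insert 0 ?B"
    by auto
  ultimately show ?thesis
    using q_gt_1 by simp
qed

lemma ex_not_fixed: "\<exists>a :: 'k. a ^ q \<noteq> a"
proof (rule ccontr)
  assume "\<not> ?thesis"
  then have "{c :: 'k. c ^ q = c} = UNIV" by auto
  then have "q = q ^ 2"
    using card_fixed card_k by simp
  then show False
    using q_gt_1 by (simp add: power2_eq_square)
qed

text \<open>Otherwise \<open>1 = - 1\<close>, so negation is the identity and every scalar would be
  fixed by conjugation.\<close>

lemma ex_not_antifixed: "\<exists>a :: 'k. a ^ q \<noteq> - a"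
proof (rule ccontr)
  assume "\<not> ?thesis"
  then have *: "a ^ q = - a" for a :: 'k by auto
  from *[of 1] have "(1 :: 'k) = - 1" by simp
  then have "- a = a" for a :: 'k
    by (metis mult_1 mult_minus_left)
  with * ex_not_fixed show False by auto
qed

end

section \<open>Isotropic vectors of a Hermitian space\<close>

context hermitian_space
begin

lemma mem_orth: "y \<in> orth \<eta> S \<longleftrightarrow> (\<forall>x\<in>S. \<eta> y x = 0)"
  using sym_zero by (auto simp: orth_def)

lemma subspace_orth: "vec.subspace (orth \<eta> S)"
  by (auto simp: vec.subspace_def mem_orth)

lemma orth_span: "orth \<eta> (vec.span S) = orth \<eta> S"
proof
  show "orth \<eta> (vec.span S) \<subseteq> orth \<eta> S"
    by (auto simp: orth_def vec.span_base)
  have "vec.span S \<subseteq> {x. \<eta> x y = 0}" if "y \<in> orth \<eta> S" for y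
    using that by (intro vec.span_minimal) (auto simp: orth_def vec.subspace_def)
  then show "orth \<eta> S \<subseteq> orth \<eta> (vec.span S)"
    by (auto simp: orth_def)
qed

lemma orth_insert: "orth \<eta> (insert b B) = {y \<in> orth \<eta> B. \<eta> y b = 0}"
  by (auto simp: mem_orth)

lemma orth_UNIV: "orth \<eta> UNIV = {0}"
  using nondegD by (auto simp: mem_orth)

text \<open>Each further vector imposes one linear condition, so the dimension drops by at most
  one.\<close>

lemma dim_orth_ge:
  assumes "finite B"
  shows "CARD('n) \<le> vec.dim (orth \<eta> B) + card B"
  using assms
proof (induction B rule: finite_induct)
  case empty
  then show ?case by (simp add: orth_def vec_dim_card del: vec.dim_UNIV)
next
  case (insert b B)
  have "vec.dim (orth \<eta> B) \<le> vec.dim (orth \<eta> (insert b B)) + 1"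
  proof (cases "\<exists>x\<in>orth \<eta> B. \<eta> x b \<noteq> 0")
    case True
    then show ?thesis
      using dim_hyperplane_section[OF subspace_orth linear_left, of _ B b]
      by (auto simp: orth_insert)
  next
    case False
    then have "orth \<eta> (insert b B) = orth \<eta> B"
      by (auto simp: orth_insert)
    then show ?thesis by simp
  qed
  with insert show ?case by simp
qed

text \<open>Extend a basis \<open>B\<close> of \<open>L\<close> to a basis \<open>C\<close> of the
  whole space. The orthogonal spaces of \<open>B\<close> and \<open>C - B\<close> meet trivially by
  non-degeneracy, so the lower bounds on their dimensions are both sharp.\<close>

lemma dim_orth:
  assumes "vec.subspace L"
  shows "vec.dim (orth \<eta> L) + vec.dim L = CARD('n)"
proof -
  obtain B where B: "B \<subseteq> L" "vec.independent B" "L \<subseteq> vec.span B" "card B = vec.dim L"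
    using vec.basis_exists[of L] by metis
  have L: "L = vec.span B"
    using B assms by (metis vec.span_subspace)
  obtain C where C: "B \<subseteq> C" "vec.independent C" "UNIV \<subseteq> vec.span C"
    using vec.maximal_independent_subset_extend[OF subset_UNIV B(2)] by metis
  have "finite C" "finite B"
    using C B vec.finiteI_independent by auto
  have cardC: "card C = CARD('n)"
    using vec.basis_card_eq_dim[OF subset_UNIV C(3,2)] unfolding vec_dim_card .
  have ge: "CARD('n) \<le> vec.dim (orth \<eta> L) + vec.dim L"
    using dim_orth_ge[OF \<open>finite B\<close>] B(4) unfolding L orth_span by simp
  have "orth \<eta> B \<inter> orth \<eta> (C - B) = orth \<eta> C"
    using C(1) by (auto simp: orth_def)
  also have "\<dots> = orth \<eta> UNIV"
    using C(3) by (metis orth_span top.extremum_uniqueI)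
  finally have "vec.dim (orth \<eta> B) + vec.dim (orth \<eta> (C - B)) \<le> CARD('n)"
    by (intro dim_add_le_of_Int_trivial subspace_orth) (simp add: orth_UNIV)
  moreover have "CARD('n) \<le> vec.dim (orth \<eta> (C - B)) + card (C - B)"
    using \<open>finite C\<close> by (intro dim_orth_ge) auto
  moreover have "card (C - B) = CARD('n) - vec.dim L"
    using C(1) \<open>finite B\<close> B(4) cardC by (simp add: card_Diff_subset)
  moreover have "vec.dim L \<le> CARD('n)"
    by (rule dim_le_card_vec)
  moreover have "orth \<eta> L = orth \<eta> B"
    unfolding L orth_span ..
  ultimately show ?thesis
    using ge by simp
qed

lemma orth_orth:
  assumes "vec.subspace L"
  shows "orth \<eta> (orth \<eta> L) = L"
proof -
  have "L \<subseteq> orth \<eta> (orth \<eta> L)"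
    using sym_zero by (fastforce simp: orth_def)
  moreover have "vec.dim (orth \<eta> (orth \<eta> L)) = vec.dim L"
    using dim_orth[OF assms] dim_orth[OF subspace_orth[of L]] by simp
  ultimately show ?thesis
    using vec.subspace_dim_equal[OF assms subspace_orth] by (metis order_refl)
qed

lemma radical_on_eq: "radical_on U \<eta> = U \<inter> orth \<eta> U"
  by (auto simp: radical_on_def mem_orth)

text \<open>The orthogonal space of the kernel of \<open>g\<close> is one-dimensional; a generator
  represents \<open>g\<close> after rescaling.\<close>

lemma ex_representing_vector:
  assumes g: "Vector_Spaces.linear (*s) (*) g"
  shows "\<exists>w. \<forall>y. g y = \<eta> y w"
proof (cases "\<exists>x. g x \<noteq> 0")
  case False
  then show ?thesis by (intro exI[of _ 0]) auto
next
  case True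
  then obtain x where x: "g x \<noteq> 0" by blast
  interpret g: Vector_Spaces.linear "(*s)" "(*)" g by (rule g)
  let ?H = "{y. g y = 0}"
  have H: "vec.subspace ?H"
    by (auto simp: vec.subspace_def g.add g.scale g.zero)
  have "vec.dim ?H + 1 = CARD('n)"
    using dim_hyperplane_section[OF vec.subspace_UNIV g, of x] x by (simp add: vec_dim_card del: vec.dim_UNIV)
  then have "vec.dim (orth \<eta> ?H) = 1"
    using dim_orth[OF H] by simp
  then have "\<not> orth \<eta> ?H \<subseteq> {0}"
    by (metis vec.dim_eq_0 zero_neq_one)
  then obtain w where w: "w \<in> orth \<eta> ?H" "w \<noteq> 0" by blast
  have eq: "\<eta> y w = g y / g x * \<eta> x w" for y
  proof -
    have "y - (g y / g x) *s x \<in> ?H"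
      using x by (simp add: g.diff g.scale)
    then have "\<eta> (y - (g y / g x) *s x) w = 0"
      using w(1) by (auto simp: orth_def)
    then show ?thesis by simp
  qed
  have "\<eta> x w \<noteq> 0"
    using eq w(2) nondegD sym_zero by (metis mult_zero_right)
  \<comment> \<open>The factor is conjugated because the second argument is semilinear; the second
    conjugation cancels the first.\<close>
  then have "g y = \<eta> y ((g x / \<eta> x w) ^ q *s w)" for y
    using eq[of y] x by simp
  then show ?thesis by blast
qed

section \<open>Counting isotropic vectors of a subspace\<close>

definition isotropics :: "('k ^ 'n) set \<Rightarrow> ('k ^ 'n) set" where
  "isotropics U = {x \<in> U. \<eta> x x = 0}"

lemma card_subspace_q: "vec.subspace U \<Longrightarrow> card U = q ^ (2 * vec.dim U)"
  for U :: "('k ^ 'n) set"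
  by (simp add: card_subspace card_k power_mult)

text \<open>Polarisation: if \<open>\<eta> x y\<close> were nonzero, a suitable multiple of
  \<open>y\<close> added to \<open>x\<close> would give \<open>b ^ q + b = 0\<close> for every
  scalar \<open>b\<close>.\<close>

lemma totally_isotropic_if_isotropic:
  assumes U: "vec.subspace U" and iso: "\<And>x. x \<in> U \<Longrightarrow> \<eta> x x = 0"
    and xy: "x \<in> U" "y \<in> U"
  shows "\<eta> x y = 0"
proof (rule ccontr)
  assume h: "\<eta> x y \<noteq> 0"
  have "b ^ q = - b" for b :: 'k
  proof -
    let ?a = "b / \<eta> x y ^ q"
    have "\<eta> (x + ?a *s y) (x + ?a *s y) = 0"
      by (rule iso) (use U xy in \<open>auto intro: vec.subspace_add vec.subspace_scale\<close>)
    then have "?a ^ q * \<eta> x y + ?a * \<eta> y x = 0"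
      using iso[OF xy(1)] iso[OF xy(2)] by (simp add: add.commute)
    moreover have "?a ^ q * \<eta> x y = b ^ q" "?a * \<eta> y x = b"
      using h conj[where x=x and y=y] by (auto simp: power_divide)
    ultimately show ?thesis
      by (simp add: eq_neg_iff_add_eq_0)
  qed
  then show False
    using ex_not_antifixed by blast
qed

text \<open>Induction on the dimension by splitting off a non-isotropic \<open>x\<close>. For
  \<open>y\<close> orthogonal to \<open>x\<close>, isotropy of \<open>a *s x + y\<close> prescribes
  the norm of \<open>a\<close>, with one solution if \<open>y\<close> is isotropic and
  \<open>q + 1\<close> otherwise. The factor \<open>q\<close> on the left avoids a division.\<close>

lemma card_isotropics:
  assumes "vec.subspace U"
  shows "int q * int (card (isotropics U)) =
    int q ^ (2 * vec.dim U) + (- int q) ^ (vec.dim U + vec.dim (radical_on U \<eta>)) * (int q - 1)"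
  using assms
proof (induction "vec.dim U" arbitrary: U rule: less_induct)
  case less
  note U = \<open>vec.subspace U\<close>
  show ?case
  proof (cases "\<forall>x\<in>U. \<eta> x x = 0")
    case True
    then have "isotropics U = U" "radical_on U \<eta> = U"
      using totally_isotropic_if_isotropic[OF U] by (auto simp: isotropics_def radical_on_def)
    then show ?thesis
      using card_subspace_q[OF U] by (simp add: algebra_simps flip: mult_2)
  next
    case False
    then obtain x where x: "x \<in> U" "\<eta> x x \<noteq> 0" by blast
    let ?U = "{y \<in> U. \<eta> y x = 0}"
    have U': "vec.subspace ?U"
      using U by (auto simp: vec.subspace_def)
    have dim: "vec.dim U = vec.dim ?U + 1"
      using dim_hyperplane_section[OF U linear_left x] by simp
    have decomp: "y - (\<eta> y x / \<eta> x x) *s x \<in> ?U" if "y \<in> U" for y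
      using that x U by (auto intro: vec.subspace_diff vec.subspace_scale)
    \<comment> \<open>Every vector of \<open>U\<close> differs from one of \<open>?U\<close> by a
      multiple of \<open>x\<close>, to which \<open>?U\<close> is orthogonal; so the radical
      survives the splitting.\<close>
    have rad: "radical_on U \<eta> = radical_on ?U \<eta>"
    proof
      show "radical_on U \<eta> \<subseteq> radical_on ?U \<eta>"
        using x by (auto simp: radical_on_def)
      show "radical_on ?U \<eta> \<subseteq> radical_on U \<eta>"
      proof
        fix z assume z: "z \<in> radical_on ?U \<eta>"
        have "\<eta> z y = 0" if "y \<in> U" for y
        proof -
          have "\<eta> z (y - (\<eta> y x / \<eta> x x) *s x) = 0"
            using z decomp[OF that] unfolding radical_on_def by blast
          then show ?thesis
            using z by (simp add: radical_on_def)
        qed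
        with z show "z \<in> radical_on U \<eta>"
          by (simp add: radical_on_def)
      qed
    qed
    let ?S = "SIGMA y:?U. {a. a ^ (q + 1) = - \<eta> y y / \<eta> x x}"
    let ?g = "\<lambda>(y, a). a *s x + y"
    have form: "\<eta> (a *s x + y) (a *s x + y) = 0 \<longleftrightarrow> a ^ (q + 1) = - \<eta> y y / \<eta> x x"
      if "y \<in> ?U" for a y
    proof -
      have yx: "\<eta> y x = 0" "\<eta> x y = 0"
        using that sym_zero by auto
      have "\<eta> (a *s x + y) (a *s x + y) = a ^ (q + 1) * \<eta> x x + \<eta> y y"
        using yx by simp
      moreover have "c * \<eta> x x + \<eta> y y = 0 \<longleftrightarrow> c = - \<eta> y y / \<eta> x x" for c
        using x(2) by (metis nonzero_eq_divide_eq eq_neg_iff_add_eq_0)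
      ultimately show ?thesis
        by (simp only:)
    qed
    have "isotropics U = ?g ` ?S"
    proof
      show "?g ` ?S \<subseteq> isotropics U"
        using form x U by (auto simp: isotropics_def intro!: vec.subspace_add vec.subspace_scale)
      show "isotropics U \<subseteq> ?g ` ?S"
      proof
        fix y assume y: "y \<in> isotropics U"
        let ?a = "\<eta> y x / \<eta> x x"
        have "y - ?a *s x \<in> ?U"
          using y decomp by (auto simp: isotropics_def)
        moreover have "\<eta> (?a *s x + (y - ?a *s x)) (?a *s x + (y - ?a *s x)) = 0"
          using y by (simp only: add_diff_cancel_left' add_diff_eq) (simp add: isotropics_def)
        then have "?a ^ (q + 1) = - \<eta> (y - ?a *s x) (y - ?a *s x) / \<eta> x x"
          using form[OF calculation, of ?a] by blast
        ultimately show "y \<in> ?g ` ?S"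
          by (intro image_eqI[of _ _ "(y - ?a *s x, ?a)"] SigmaI CollectI) (simp, blast+)
      qed
    qed
    moreover have "inj_on ?g ?S"
    proof (rule inj_onI, clarsimp)
      fix y a y' a'
      assume y: "\<eta> y x = 0" "\<eta> y' x = 0" and eq: "a *s x + y = a' *s x + y'"
      from eq have "\<eta> (a *s x + y) x = \<eta> (a' *s x + y') x" by simp
      with y x have "a = a'" by simp
      with eq show "y = y' \<and> a = a'" by simp
    qed
    ultimately have "card (isotropics U) = card ?S"
      by (simp add: card_image)
    also have "\<dots> = (\<Sum>y\<in>?U. if \<eta> y y = 0 then 1 else q + 1)"
    proof (subst card_SigmaI)
      show "(\<Sum>y\<in>?U. card {a. a ^ (q + 1) = - \<eta> y y / \<eta> x x})
          = (\<Sum>y\<in>?U. if \<eta> y y = 0 then 1 else q + 1)"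
      proof (intro sum.cong refl)
        fix y
        \<comment> \<open>Diagonal values of the form are fixed by conjugation, so the prescribed
          value is a norm.\<close>
        have "(- \<eta> y y / \<eta> x x) ^ q = - \<eta> y y / \<eta> x x"
          using conj[of y y] conj[of x x] by (simp add: power_divide)
        then have "card {a. a ^ (q + 1) = - \<eta> y y / \<eta> x x} = q + 1" if "\<eta> y y \<noteq> 0"
          using that x by (intro card_norm_fibre) auto
        moreover have "{a :: 'k. a ^ (q + 1) = 0} = {0}"
          by auto
        ultimately show "card {a. a ^ (q + 1) = - \<eta> y y / \<eta> x x} = (if \<eta> y y = 0 then 1 else q + 1)"
          by auto
      qed
    qed auto
    also have "\<dots> = card (isotropics ?U) + (q + 1) * card (?U - isotropics ?U)"
    proof -
      have "{y \<in> U. \<eta> y x = 0 \<and> \<eta> y y = 0} = isotropics ?U"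
        "{y \<in> U. \<eta> y x = 0 \<and> \<eta> y y \<noteq> 0} = ?U - isotropics ?U"
        by (auto simp: isotropics_def)
      then show ?thesis
        by (subst sum.If_cases) (auto simp: Int_def isotropics_def)
    qed
    finally have "int (card (isotropics U)) = int (card (isotropics ?U)) + (int q + 1) * int (card (?U - isotropics ?U))"
      by (simp add: algebra_simps)
    moreover have "int (card (?U - isotropics ?U)) = int (card ?U) - int (card (isotropics ?U))"
      by (rule int_card_Diff_subset) (auto simp: isotropics_def)
    \<comment> \<open>A recurrence linking the counts for \<open>U\<close> and \<open>?U\<close>;
      the alternating sign in the formula comes from it.\<close>
    ultimately have N: "int (card (isotropics U)) + int q * int (card (isotropics ?U)) = (int q + 1) * int q ^ (2 * vec.dim ?U)"
      using card_subspace_q[OF U'] by (simp add: algebra_simps)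
    have IH: "int q * int (card (isotropics ?U)) =
      int q ^ (2 * vec.dim ?U) + (- int q) ^ (vec.dim ?U + vec.dim (radical_on ?U \<eta>)) * (int q - 1)"
      by (rule less) (use dim U' in auto)
    have "int q * int (card (isotropics U)) = int q * ((int q + 1) * int q ^ (2 * vec.dim ?U))
        - int q * (int q * int (card (isotropics ?U)))"
      using arg_cong[OF N, of "\<lambda>z. int q * z"] by (simp add: algebra_simps)
    then show ?thesis
      unfolding IH rad dim by (simp add: algebra_simps)
  qed
qed

end

section \<open>Counting pairs with an alternating form\<close>

locale alternating_hermitian = hermitian_space q \<eta>
  for q :: nat and \<eta> :: "'k::{field,finite} ^ 'n::finite \<Rightarrow> 'k ^ 'n \<Rightarrow> 'k" +
  fixes \<phi> :: "'k ^ 'n \<Rightarrow> 'k ^ 'n \<Rightarrow> 'k"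
  assumes alternating: "alternating_form \<phi>"
begin

lemma phi_linear_left: "Vector_Spaces.linear (*s) (*) (\<lambda>x. \<phi> x y)"
  and phi_linear_right: "Vector_Spaces.linear (*s) (*) (\<phi> x)"
  and phi_self [simp]: "\<phi> x x = 0"
  using alternating unfolding alternating_form_def by blast+

lemma phi_add_left [simp]: "\<phi> (x + y) z = \<phi> x z + \<phi> y z"
  and phi_scale_left [simp]: "\<phi> (a *s x) z = a * \<phi> x z"
  using phi_linear_left[of z] unfolding Vector_Spaces.linear_iff by blast+

lemma phi_add_right [simp]: "\<phi> x (y + z) = \<phi> x y + \<phi> x z"
  and phi_scale_right [simp]: "\<phi> x (a *s y) = a * \<phi> x y"
  using phi_linear_right[of x] unfolding Vector_Spaces.linear_iff by blast+

lemma phi_zero [simp]: "\<phi> 0 x = 0" "\<phi> x 0 = 0"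
  using phi_scale_left[of 0 0 x] phi_scale_right[of x 0 0] by simp_all

lemma phi_swap: "\<phi> y x = - \<phi> x y"
proof -
  have "\<phi> (x + y) (x + y) = 0" by (rule phi_self)
  then show ?thesis
    by (simp only: phi_add_left phi_add_right) (simp add: eq_neg_iff_add_eq_0 add.commute)
qed

section \<open>The semilinear map attached to an alternating form\<close>

definition adj :: "'k ^ 'n \<Rightarrow> 'k ^ 'n" where
  "adj u = (SOME w. \<forall>y. \<phi> y u = \<eta> y w)"

lemma phi_eq: "\<phi> y u = \<eta> y (adj u)"
  unfolding adj_def using someI_ex[OF ex_representing_vector[OF phi_linear_left[of u]]] by blast

lemma adj_eqI: "(\<And>y. \<phi> y u = \<eta> y w) \<Longrightarrow> adj u = w"
proof -
  assume "\<And>y. \<phi> y u = \<eta> y w"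
  then have "\<eta> y (adj u - w) = 0" for y
    using phi_eq[of y u] by simp
  then have "adj u - w = 0"
    using nondegD sym_zero by blast
  then show ?thesis by simp
qed

lemma adj_add: "adj (u + v) = adj u + adj v"
  by (rule adj_eqI) (simp add: phi_eq flip: phi_eq)

lemma adj_scale: "adj (a *s u) = a ^ q *s adj u"
  by (rule adj_eqI) (simp flip: phi_eq)

lemma adj_zero [simp]: "adj 0 = 0"
  using adj_scale[of 0 0] q_gt_1 by simp

text \<open>Antisymmetry of \<open>\<phi>\<close> carried over to \<open>adj\<close>, which is
  skew-adjoint up to conjugation.\<close>

lemma adj_swap: "\<eta> x (adj y) = - (\<eta> (adj x) y ^ q)"
  using phi_swap[of x y] phi_eq conj by metis

lemma eta_self_adj: "\<eta> u (adj u) = 0" "\<eta> (adj u) u = 0"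
  using phi_eq[of u u] sym_zero by auto

lemma radical_phi: "radical \<phi> = {u. adj u = 0}"
proof -
  have "u \<in> radical \<phi> \<longleftrightarrow> adj u = 0" for u
  proof -
    have "u \<in> radical \<phi> \<longleftrightarrow> (\<forall>y. \<phi> y u = 0)"
      using phi_swap[of u] by (auto simp: radical_on_def)
    also have "\<dots> \<longleftrightarrow> adj u = 0"
      using adj_eqI[of u 0] phi_eq[of _ u] by auto
    finally show ?thesis .
  qed
  then show ?thesis by blast
qed

lemma subspace_radical: "vec.subspace (radical \<phi>)"
  by (auto simp: radical_phi vec.subspace_def adj_add adj_scale)

text \<open>These are the isotropic \<open>u\<close> for which \<open>\<phi>\<close> against
  \<open>u\<close> vanishes on the whole orthogonal space of \<open>u\<close>. Eigenvalue zero is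
  allowed, so the isotropic vectors of the radical belong here.\<close>

definition eigs :: "('k ^ 'n) set" where
  "eigs = {u. \<eta> u u = 0 \<and> adj u \<in> vec.span {u}}"

definition noniso_images :: "('k ^ 'n) set" where
  "noniso_images = {u. \<eta> u u = 0 \<and> \<eta> (adj u) (adj u) \<noteq> 0}"

definition partners :: "'k ^ 'n \<Rightarrow> ('k ^ 'n) set" where
  "partners u = {v. \<eta> v v = 0 \<and> \<eta> v u = 0 \<and> \<phi> v u \<noteq> 0}"

lemma partners_eig: "adj u \<in> vec.span {u} \<Longrightarrow> partners u = {}"
  by (auto simp: partners_def phi_eq in_span_singleton)

text \<open>The partners are the isotropic vectors of \<open>?A\<close> outside \<open>?B\<close>.
  The dimensions are \<open>k + 1\<close> and \<open>k\<close>; the radical of \<open>?A\<close> is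
  the line of \<open>u\<close>, and that of \<open>?B\<close> has dimension 2 or 1 according to
  whether \<open>adj u\<close> is isotropic.\<close>

lemma card_partners:
  assumes k: "CARD('n) = k + 2" "even k"
    and u: "\<eta> u u = 0" "adj u \<notin> vec.span {u}"
  shows "int q * int (card (partners u)) =
    (int q ^ 2 - 1) * (int q ^ (2 * k) + (if \<eta> (adj u) (adj u) = 0 then 0 else int q ^ (k + 1)))"
proof -
  let ?w = "adj u"
  let ?A = "orth \<eta> (vec.span {u})" and ?B = "orth \<eta> (vec.span {u, ?w})"
  have u0: "u \<noteq> 0"
    using u(2) by (auto simp: vec.span_zero)
  have sub: "?B \<subseteq> ?A"
    unfolding orth_span by (auto simp: orth_def)
  have "partners u = isotropics ?A - isotropics ?B"
    by (auto simp: partners_def isotropics_def orth_span mem_orth phi_eq)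
  moreover have "isotropics ?B \<subseteq> isotropics ?A"
    using sub by (auto simp: isotropics_def)
  ultimately have "int (card (partners u)) = int (card (isotropics ?A)) - int (card (isotropics ?B))"
    by (simp add: int_card_Diff_subset)
  then have *: "int q * int (card (partners u)) = int q * int (card (isotropics ?A)) - int q * int (card (isotropics ?B))"
    by (simp only: right_diff_distrib)
  have dA: "vec.dim ?A = k + 1"
    using dim_orth[of "vec.span {u}"] k u0 by (simp add: card_cart_basis)
  have "vec.dim (vec.span {u, ?w}) = 2"
    using u0 u(2) by (simp only: dim_span_pair if_False)
  then have dB: "vec.dim ?B = k"
    using dim_orth[of "vec.span {u, ?w}"] k by simp
  have "vec.span {u} \<subseteq> ?A"
    using u by (auto simp: orth_span mem_orth in_span_singleton)
  then have "radical_on ?A \<eta> = vec.span {u}"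
    unfolding radical_on_eq orth_orth[OF vec.subspace_span] by blast
  then have rA: "vec.dim (radical_on ?A \<eta>) = 1"
    using u0 by simp
  have rB': "radical_on ?B \<eta> = ?B \<inter> vec.span {u, ?w}"
    unfolding radical_on_eq orth_orth[OF vec.subspace_span] ..
  have rB: "vec.dim (radical_on ?B \<eta>) = (if \<eta> ?w ?w = 0 then 2 else 1)"
  proof (cases "\<eta> ?w ?w = 0")
    case True
    then have "vec.span {u, ?w} \<subseteq> ?B"
      using u eta_self_adj by (auto simp: orth_span mem_orth in_span_pair)
    then have "radical_on ?B \<eta> = vec.span {u, ?w}"
      using rB' by blast
    with True show ?thesis
      using u0 u(2) by (simp only: dim_span_pair if_False if_True simp_thms)
  next
    case False
    then have "radical_on ?B \<eta> = vec.span {u}"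
      unfolding rB' using u eta_self_adj
      by (auto simp: orth_span mem_orth in_span_pair in_span_singleton)
        (metis add.right_neutral vec.scale_zero_left)
    with False show ?thesis
      using u0 by simp
  qed
  \<comment> \<open>The exponents in \<open>card_isotropics\<close> are \<open>k + 2\<close> for
    \<open>?A\<close>, and \<open>k + 2\<close> or \<open>k + 1\<close> for \<open>?B\<close>. Only
    the last is odd; its negative sign produces the extra term for non-isotropic
    \<open>adj u\<close>.\<close>
  have e: "(- int q) ^ (k + 2) = int q ^ (k + 2)" "(- int q) ^ k = int q ^ k"
    using k(2) by auto
  have A: "int q * int (card (isotropics ?A)) = int q ^ (2 * k + 2) + int q ^ (k + 2) * (int q - 1)"
    using card_isotropics[OF subspace_orth[of "vec.span {u}"]] dA rA e by simp
  have B: "int q * int (card (isotropics ?B)) = int q ^ (2 * k) +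
    (if \<eta> ?w ?w = 0 then int q ^ (k + 2) else - (int q ^ (k + 1))) * (int q - 1)"
    using card_isotropics[OF subspace_orth[of "vec.span {u, ?w}"]] dB rB e by simp
  show ?thesis
    unfolding * A B by (simp add: power_add power2_eq_square algebra_simps)
qed

definition phi_pairs :: "(('k ^ 'n) \<times> ('k ^ 'n)) set" where
  "phi_pairs = {(u, v). \<eta> u u = 0 \<and> \<eta> v v = 0 \<and> \<eta> v u = 0 \<and> \<phi> v u \<noteq> 0}"

text \<open>Summation over the first vector: \<open>eigs\<close> contributes nothing, and every
  other isotropic vector the same amount, plus a surcharge on \<open>noniso_images\<close>.\<close>

lemma card_phi_pairs:
  assumes k: "CARD('n) = k + 2" "even k"
  shows "int q * int (card phi_pairs) = (int q ^ 2 - 1) *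
    (int q ^ (2 * k) * (int (card (isotropics UNIV)) - int (card eigs)) + int q ^ (k + 1) * int (card noniso_images))"
proof -
  let ?I = "isotropics UNIV"
  let ?J = "?I - eigs"
  have D: "noniso_images \<subseteq> ?J"
    by (auto simp: noniso_images_def eigs_def isotropics_def in_span_singleton)
  have "phi_pairs = (SIGMA u:?I. partners u)"
    by (auto simp: phi_pairs_def isotropics_def partners_def)
  then have "card phi_pairs = (\<Sum>u\<in>?I. card (partners u))"
    by (simp add: card_SigmaI)
  also have "\<dots> = (\<Sum>u\<in>?J. card (partners u))"
    by (rule sum.mono_neutral_right) (auto simp: eigs_def partners_eig)
  finally have "int q * int (card phi_pairs) = (\<Sum>u\<in>?J. int q * int (card (partners u)))"
    by (simp add: sum_distrib_left)
  also have "\<dots> = (\<Sum>u\<in>?J. (int q ^ 2 - 1) * int q ^ (2 * k) +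
      (if u \<in> noniso_images then (int q ^ 2 - 1) * int q ^ (k + 1) else 0))"
  proof (intro sum.cong refl)
    fix u assume "u \<in> ?J"
    then show "int q * int (card (partners u)) = (int q ^ 2 - 1) * int q ^ (2 * k) +
      (if u \<in> noniso_images then (int q ^ 2 - 1) * int q ^ (k + 1) else 0)"
      using card_partners[OF k, of u] by (simp add: isotropics_def eigs_def noniso_images_def distrib_left)
  qed
  also have "\<dots> = int (card ?J) * ((int q ^ 2 - 1) * int q ^ (2 * k)) +
      int (card noniso_images) * ((int q ^ 2 - 1) * int q ^ (k + 1))"
    using D by (simp add: sum.distrib sum.If_cases Int_absorb1 Int_absorb2)
  also have "int (card ?J) = int (card ?I) - int (card eigs)"
    by (rule int_card_Diff_subset) (auto simp: isotropics_def eigs_def)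
  finally show ?thesis
    by (simp add: algebra_simps)
qed

end

section \<open>Eigenvectors of the semilinear map\<close>

context alternating_hermitian
begin

definition eigenspace :: "'k \<Rightarrow> ('k ^ 'n) set" where
  "eigenspace l = {u. adj u = l *s u}"

text \<open>The square of \<open>adj\<close> is linear because conjugation is an involution. So this
  is a genuine subspace, and it bounds the eigenspaces of \<open>adj\<close>.\<close>

definition adj2_eigenspace :: "'k \<Rightarrow> ('k ^ 'n) set" where
  "adj2_eigenspace c = {u. adj (adj u) = c *s u}"

lemma subspace_adj2_eigenspace: "vec.subspace (adj2_eigenspace c)"
  by (auto simp: adj2_eigenspace_def vec.subspace_def adj_add adj_scale vec.scale_right_distrib mult.commute)

lemma adj_diff: "adj (u - v) = adj u - adj v"
  using adj_add[of "u - v" v] by simp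

lemma eigenspace_zero: "0 \<in> eigenspace l"
  by (simp add: eigenspace_def)

lemma eigenspace_diff: "u \<in> eigenspace l \<Longrightarrow> v \<in> eigenspace l \<Longrightarrow> u - v \<in> eigenspace l"
  by (simp add: eigenspace_def adj_diff vec.scale_right_diff_distrib)

lemma eigenspace_subset_adj2: "eigenspace l \<subseteq> adj2_eigenspace (l ^ (q + 1))"
  by (auto simp: eigenspace_def adj2_eigenspace_def adj_scale mult.commute)

lemma eigenspace_isotropic:
  assumes "l \<noteq> 0" "u \<in> eigenspace l"
  shows "\<eta> u u = 0"
  using eta_self_adj(2)[of u] assms by (simp add: eigenspace_def)

text \<open>An eigenspace is only a vector space over the fixed field of \<open>x \<mapsto> x ^ q\<close>; its sum with a
  multiple of itself by a non-fixed scalar is direct.\<close>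

lemma inj_on_eigenspace_extension:
  assumes l: "l \<noteq> 0" and a: "a ^ q \<noteq> a"
  shows "inj_on (\<lambda>(s, t). s + a *s t) (eigenspace l \<times> eigenspace l)"
proof (rule inj_onI, clarsimp)
  fix s t s' t'
  assume S: "s \<in> eigenspace l" "t \<in> eigenspace l" "s' \<in> eigenspace l" "t' \<in> eigenspace l"
    and eq: "s + a *s t = s' + a *s t'"
  let ?u = "s - s'" and ?v = "t' - t"
  have uv: "?u \<in> eigenspace l" "?v \<in> eigenspace l"
    using S eigenspace_diff by auto
  have 1: "?u = a *s ?v"
    using eq by (simp add: vec.scale_right_diff_distrib algebra_simps)
  have "adj ?u = a ^ q *s adj ?v"
    by (subst 1) (rule adj_scale)
  then have "l *s ?u = a ^ q *s (l *s ?v)"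
    using uv by (simp add: eigenspace_def)
  then have "l *s (a *s ?v) = a ^ q *s (l *s ?v)"
    by (simp only: 1)
  then have "(l * a - a ^ q * l) *s ?v = 0"
    by (simp only: vec.scale_left_diff_distrib vec.scale_scale right_minus_eq)
  moreover have "l * a - a ^ q * l \<noteq> 0"
    using l a by (simp add: mult.commute)
  ultimately have "?v = 0"
    by (metis vec.scale_eq_0_iff)
  with 1 show "s = s' \<and> t = t'"
    by simp
qed

text \<open>The direct sum of the eigenspace with its multiple by a non-fixed scalar embeds into
  \<open>?W\<close>, so the square of its size is at most
  \<open>q ^ (2 * vec.dim ?W)\<close>.\<close>

lemma card_eigenspace_le:
  assumes "l \<noteq> 0"
  shows "card (eigenspace l) \<le> q ^ vec.dim (adj2_eigenspace (l ^ (q + 1)))"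
proof -
  let ?S = "eigenspace l" and ?W = "adj2_eigenspace (l ^ (q + 1))"
  obtain a :: 'k where a: "a ^ q \<noteq> a"
    using ex_not_fixed by blast
  have "(\<lambda>(s, t). s + a *s t) ` (?S \<times> ?S) \<subseteq> ?W"
    using eigenspace_subset_adj2[of l] subspace_adj2_eigenspace
    by (force intro: vec.subspace_add vec.subspace_scale)
  then have "card (?S \<times> ?S) \<le> card ?W"
    using card_inj_on_le[OF inj_on_eigenspace_extension[OF assms a]] by simp
  then have "card ?S ^ 2 \<le> (q ^ vec.dim ?W) ^ 2"
    by (simp add: card_cartesian_product card_subspace_q[OF subspace_adj2_eigenspace] power2_eq_square
        mult_2 power_add)
  then show ?thesis
    by (rule power2_le_imp_le) simp
qed

text \<open>The radical is the kernel of \<open>adj\<close>, so it meets an eigenspace of the square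
  for a nonzero eigenvalue trivially.\<close>

lemma dim_adj2_eigenspace_le:
  assumes "c \<noteq> 0"
  shows "vec.dim (adj2_eigenspace c) + vec.dim (radical \<phi>) \<le> CARD('n)"
  using assms
  by (intro dim_add_le_of_Int_trivial subspace_adj2_eigenspace subspace_radical)
    (auto simp: adj2_eigenspace_def radical_phi vec.scale_eq_0_iff)

text \<open>Sorting by eigenvalue. For a nonzero eigenvalue isotropy is automatic, because
  \<open>\<eta> (adj u) u = 0\<close>.\<close>

lemma eigs_eq: "eigs = isotropics (radical \<phi>) \<union> (\<Union>l\<in>-{0}. eigenspace l - {0})"
proof
  show "eigs \<subseteq> isotropics (radical \<phi>) \<union> (\<Union>l\<in>-{0}. eigenspace l - {0})"
  proof
    fix u assume "u \<in> eigs"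
    then obtain l where u: "\<eta> u u = 0" "adj u = l *s u"
      by (auto simp: eigs_def in_span_singleton)
    show "u \<in> isotropics (radical \<phi>) \<union> (\<Union>l\<in>-{0}. eigenspace l - {0})"
      using u by (cases "u = 0"; cases "l = 0") (auto simp: isotropics_def radical_phi eigenspace_def)
  qed
  show "isotropics (radical \<phi>) \<union> (\<Union>l\<in>-{0}. eigenspace l - {0}) \<subseteq> eigs"
    using eigenspace_isotropic
    by (auto simp: isotropics_def radical_phi eigs_def vec.span_zero in_span_singleton eigenspace_def)
qed

lemma int_card_eigs:
  "int (card eigs) = int (card (isotropics (radical \<phi>))) + (\<Sum>l\<in>-{0}. int (card (eigenspace l)) - 1)"
proof -
  have "card eigs = card (isotropics (radical \<phi>)) + card (\<Union>l\<in>-{0}. eigenspace l - {0})"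
    unfolding eigs_eq
    by (rule card_Un_disjoint) (auto simp: isotropics_def radical_phi eigenspace_def vec.scale_eq_0_iff)
  also have "card (\<Union>l\<in>-{0}. eigenspace l - {0}) = (\<Sum>l\<in>-{0}. card (eigenspace l - {0}))"
    by (rule card_UN_disjoint) (auto simp: eigenspace_def vec.scale_cancel_right)
  finally show ?thesis
    using eigenspace_zero by (simp add: int_card_Diff_subset del: card_Diff_insert)
qed

lemma card_eigs_le:
  assumes "\<And>l. l \<noteq> 0 \<Longrightarrow> card (eigenspace l) \<le> q ^ s"
  shows "int (card eigs) \<le> int (card (isotropics (radical \<phi>))) + (int q ^ 2 - 1) * (int q ^ s - 1)"
proof -
  have "(\<Sum>l\<in>-{0}. int (card (eigenspace l)) - 1) \<le> (\<Sum>l\<in>-{0 :: 'k}. int q ^ s - 1)"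
    using assms by (intro sum_mono diff_right_mono) (simp flip: of_nat_power)
  also have "\<dots> = (int q ^ 2 - 1) * (int q ^ s - 1)"
  proof -
    have "int (card (- {0 :: 'k})) = int q ^ 2 - 1"
      using int_card_Diff_subset[of UNIV "{0 :: 'k}"] by (simp add: card_k Compl_eq_Diff_UNIV)
    then show ?thesis by simp
  qed
  finally show ?thesis
    by (simp add: int_card_eigs)
qed

lemma card_eigs_le_rank:
  assumes "vec.dim (radical \<phi>) + r = CARD('n)"
  shows "int (card eigs) \<le> int (card (isotropics (radical \<phi>))) + (int q ^ 2 - 1) * (int q ^ r - 1)"
proof (rule card_eigs_le)
  fix l :: 'k assume l: "l \<noteq> 0"
  have "card (eigenspace l) \<le> q ^ vec.dim (adj2_eigenspace (l ^ (q + 1)))"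
    using l by (rule card_eigenspace_le)
  also have "\<dots> \<le> q ^ r"
    using dim_adj2_eigenspace_le[of "l ^ (q + 1)"] l assms q_gt_1 by (intro power_increasing) auto
  finally show "card (eigenspace l) \<le> q ^ r" .
qed

text \<open>If the square of \<open>adj\<close> is no nonzero scalar, its eigenspaces for nonzero
  eigenvalues are proper subspaces, which lowers the exponent by one.\<close>

lemma card_eigs_le_nonscalar:
  assumes "\<And>c. c \<noteq> 0 \<Longrightarrow> \<exists>u. adj (adj u) \<noteq> c *s u"
  shows "int (card eigs) \<le> int (card (isotropics (radical \<phi>))) + (int q ^ 2 - 1) * (int q ^ (CARD('n) - 1) - 1)"
proof (rule card_eigs_le)
  fix l :: 'k assume l: "l \<noteq> 0"
  let ?W = "adj2_eigenspace (l ^ (q + 1))"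
  have "?W \<noteq> UNIV"
    using assms[of "l ^ (q + 1)"] l by (auto simp: adj2_eigenspace_def)
  then have "vec.dim ?W \<noteq> vec.dim (UNIV :: ('k ^ 'n) set)"
    using vec.subspace_dim_equal[OF subspace_adj2_eigenspace vec.subspace_UNIV, of "l ^ (q + 1)"] by auto
  then have "vec.dim ?W < CARD('n)"
    using dim_le_card_vec[of ?W] unfolding vec_dim_card by simp
  have "card (eigenspace l) \<le> q ^ vec.dim ?W"
    using l by (rule card_eigenspace_le)
  also have "\<dots> \<le> q ^ (CARD('n) - 1)"
    using \<open>vec.dim ?W < CARD('n)\<close> q_gt_1 by (intro power_increasing) auto
  finally show "card (eigenspace l) \<le> q ^ (CARD('n) - 1)" .
qed

lemma isotropics_zero: "isotropics {0} = {0}"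
  by (auto simp: isotropics_def)

section \<open>Forms whose semilinear map squares to a nonzero scalar\<close>

context
  fixes c
  assumes scalar: "\<And>u. adj (adj u) = c *s u" and c: "c \<noteq> 0"
begin

text \<open>By \<open>adj_swap\<close>, \<open>\<eta> (adj u) (adj u)\<close> is minus the conjugate
  of \<open>\<eta> (adj (adj u)) u\<close>, a multiple of \<open>\<eta> u u\<close>.\<close>

lemma noniso_images_scalar: "noniso_images = {}"
  using adj_swap[of "adj u" u for u] scalar frob_zero by (auto simp: noniso_images_def simp del: power_eq_0_iff)

lemma radical_scalar: "radical \<phi> = {0}"
  using scalar c by (auto simp: radical_phi) (metis adj_zero vec.scale_eq_0_iff)

text \<open>The cube of \<open>adj\<close> is evaluated in two ways, giving
  \<open>c *s adj u = c ^ q *s adj u\<close>.\<close>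

lemma scalar_fixed: "c ^ q = c"
proof -
  obtain u :: "'k ^ 'n" where "u \<noteq> 0"
    using ex_form_eq_1 by (metis zero_left zero_neq_one)
  have "adj u \<noteq> 0"
    using \<open>u \<noteq> 0\<close> radical_scalar by (auto simp: radical_phi)
  have "c *s adj u = adj (c *s u)"
    using scalar[of "adj u"] by (simp only: scalar[of u])
  then have "c *s adj u = c ^ q *s adj u"
    by (simp only: adj_scale)
  then show ?thesis
    using \<open>adj u \<noteq> 0\<close> by (simp add: vec.scale_cancel_right)
qed

text \<open>The additive map \<open>?T\<close> sends the whole space, of size
  \<open>q ^ (2 * CARD('n))\<close>, into the eigenspace, and its fibres have at most
  \<open>q ^ CARD('n)\<close> elements. This matches the general upper bound.\<close>

lemma card_eigenspace_scalar:
  assumes "l ^ (q + 1) = c"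
  shows "card (eigenspace l) = q ^ CARD('n)"
proof (rule antisym)
  have le: "card (eigenspace l) \<le> q ^ CARD('n)" if "l \<noteq> 0" for l
  proof -
    have "card (eigenspace l) \<le> q ^ vec.dim (adj2_eigenspace (l ^ (q + 1)))"
      using that by (rule card_eigenspace_le)
    also have "\<dots> \<le> q ^ CARD('n)"
      using dim_le_card_vec q_gt_1 by (intro power_increasing) auto
    finally show ?thesis .
  qed
  have l: "l \<noteq> 0"
    using assms c q_gt_1 by auto
  then show "card (eigenspace l) \<le> q ^ CARD('n)" by (rule le)
  let ?T = "\<lambda>v. l ^ q *s v + adj v"
  have T: "?T v \<in> eigenspace l" for v
  proof -
    have "adj (?T v) = l *s adj v + (l * l ^ q) *s v"
      using scalar assms by (simp add: adj_add adj_scale)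
    then show ?thesis
      by (simp add: eigenspace_def vec.scale_right_distrib add.commute)
  qed
  have fibre: "card {v. ?T v = s} \<le> q ^ CARD('n)" for s
  proof (cases "\<exists>v. ?T v = s")
    case True
    then obtain v where v: "?T v = s" by blast
    \<comment> \<open>Two preimages differ by an element of the kernel of \<open>?T\<close>, which
      is the eigenspace for \<open>- (l ^ q)\<close>.\<close>
    have "{v. ?T v = s} \<subseteq> (\<lambda>w. v + w) ` eigenspace (- (l ^ q))"
    proof
      fix w assume "w \<in> {v. ?T v = s}"
      with v have "l ^ q *s w + adj w = l ^ q *s v + adj v" by simp
      then have "adj (w - v) = (- (l ^ q)) *s (w - v)"
        by (simp add: adj_diff vec.scale_right_diff_distrib algebra_simps)
      then show "w \<in> (\<lambda>w. v + w) ` eigenspace (- (l ^ q))"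
        by (intro image_eqI[of _ _ "w - v"]) (auto simp: eigenspace_def)
    qed
    then have "card {v. ?T v = s} \<le> card (eigenspace (- (l ^ q)))"
      by (meson card_image_le card_mono finite order_trans finite_imageI)
    also have "\<dots> \<le> q ^ CARD('n)"
      by (rule le) (use l in auto)
    finally show ?thesis .
  qed auto
  have "q ^ (2 * CARD('n)) = card (\<Union>s\<in>eigenspace l. {v. ?T v = s})"
  proof -
    have "(\<Union>s\<in>eigenspace l. {v. ?T v = s}) = UNIV"
      using T by auto
    then show ?thesis
      using card_subspace_q[OF vec.subspace_UNIV] by (simp add: card_cart_basis)
  qed
  also have "\<dots> \<le> (\<Sum>s\<in>eigenspace l. card {v. ?T v = s})"
    by (rule card_UN_le) auto
  also have "\<dots> \<le> card (eigenspace l) * q ^ CARD('n)"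
    using fibre sum_bounded_above[of "eigenspace l" "\<lambda>s. card {v. ?T v = s}" "q ^ CARD('n)"] by simp
  finally have "q ^ CARD('n) * q ^ CARD('n) \<le> card (eigenspace l) * q ^ CARD('n)"
    by (simp add: mult_2 power_add)
  then show "q ^ CARD('n) \<le> card (eigenspace l)"
    using q_gt_1 by simp
qed

lemma eigenspace_scalar:
  assumes "l ^ (q + 1) \<noteq> c"
  shows "eigenspace l = {0}"
  using eigenspace_zero eigenspace_subset_adj2[of l] assms scalar
  by (auto simp: adj2_eigenspace_def vec.scale_cancel_right)

text \<open>Only eigenvalues of norm \<open>c\<close> contribute. There are \<open>q + 1\<close> of
  them, as \<open>c\<close> is nonzero and fixed by conjugation.\<close>

lemma card_eigs_scalar: "int (card eigs) = 1 + (int q + 1) * (int q ^ CARD('n) - 1)"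
proof -
  have "(\<Sum>l\<in>-{0}. int (card (eigenspace l)) - 1) =
      (\<Sum>l\<in>-{0}. if l ^ (q + 1) = c then int q ^ CARD('n) - 1 else 0)"
    using card_eigenspace_scalar eigenspace_scalar by (intro sum.cong) (auto simp del: power_Suc)
  also have "\<dots> = (\<Sum>l | l ^ (q + 1) = c. int q ^ CARD('n) - 1)"
  proof -
    have "{l \<in> - {0}. l ^ (q + 1) = c} = {l. l ^ (q + 1) = c}"
      using c by auto
    then show ?thesis
      by (subst sum.inter_filter[symmetric]) (simp_all only: finite)
  qed
  also have "\<dots> = (int q + 1) * (int q ^ CARD('n) - 1)"
    using card_norm_fibre[OF c scalar_fixed] by simp
  finally show ?thesis
    by (simp add: int_card_eigs radical_scalar isotropics_zero)
qed

end

end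

section \<open>Upper bounds by rank\<close>

text \<open>With \<open>x = q\<close>, the left-hand sides bound \<open>E\<close> for \<open>m = 4\<close> and \<open>m = 6\<close>, rank by rank; the right-hand
  sides are the values of \<open>E\<close> when \<open>f\<^sup>2\<close> is a scalar.\<close>

lemma rank_bounds_strict:
  fixes x :: int
  assumes x: "2 \<le> x"
  shows "x ^ 3 + x ^ 3 * (x - 1) + (x ^ 2 - 1) * (x ^ 2 - 1) < 1 + (x + 1) * (x ^ 4 - 1)"
    and "x ^ 7 + x ^ 5 * (x - 1) + (x ^ 2 - 1) * (x ^ 2 - 1) < 1 + (x + 1) * (x ^ 6 - 1)"
    and "x ^ 2 + (x ^ 2 - 1) * (x ^ 3 - 1) < 1 + (x + 1) * (x ^ 4 - 1)"
    and "x ^ 6 + (x ^ 2 - 1) * (x ^ 3 - 1) < 1 + (x + 1) * (x ^ 6 - 1)"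
    and "x ^ 4 + (x ^ 2 - 1) * (x ^ 4 - 1) < 1 + (x + 1) * (x ^ 6 - 1)"
    and "x ^ 2 + (x ^ 2 - 1) * (x ^ 5 - 1) < 1 + (x + 1) * (x ^ 6 - 1)"
    and "1 + (x ^ 2 - 1) * (x ^ 3 - 1) < 1 + (x + 1) * (x ^ 4 - 1)"
    and "1 + (x ^ 2 - 1) * (x ^ 5 - 1) < 1 + (x + 1) * (x ^ 6 - 1)"
proof -
  \<comment> \<open>After expansion the inequalities are linear in the powers of \<open>x\<close>,
    and it suffices that each power is at least twice the previous one.\<close>
  have "2 * x ^ i \<le> x * x ^ i" for i
    using x by (intro mult_right_mono) auto
  from this[of 2] this[of 3] this[of 4] this[of 5] this[of 6]
  have s: "2 * x ^ 2 \<le> x ^ 3" "2 * x ^ 3 \<le> x ^ 4" "2 * x ^ 4 \<le> x ^ 5"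
    "2 * x ^ 5 \<le> x ^ 6" "2 * x ^ 6 \<le> x ^ 7"
    by (simp_all flip: power_Suc)
  have s1: "2 * x \<le> x ^ 2"
    using x by (simp add: power2_eq_square)
  have m: "x * x = x ^ 2" "x * x ^ 2 = x ^ 3" "x * x ^ 3 = x ^ 4" "x * x ^ 4 = x ^ 5" "x * x ^ 5 = x ^ 6"
    "x * x ^ 6 = x ^ 7" "x ^ 2 * x ^ 2 = x ^ 4" "x ^ 2 * x ^ 3 = x ^ 5" "x ^ 2 * x ^ 4 = x ^ 6"
    "x ^ 2 * x ^ 5 = x ^ 7" "x ^ 3 * x = x ^ 4" "x ^ 5 * x = x ^ 6"
    by (simp_all add: power_numeral_reduce)
  have d: "a * (b - 1) = a * b - a" "(a - 1) * b = a * b - b" "(a + 1) * b = a * b + b" for a b :: int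
    by (simp_all add: algebra_simps)
  show "x ^ 3 + x ^ 3 * (x - 1) + (x ^ 2 - 1) * (x ^ 2 - 1) < 1 + (x + 1) * (x ^ 4 - 1)"
    and "x ^ 7 + x ^ 5 * (x - 1) + (x ^ 2 - 1) * (x ^ 2 - 1) < 1 + (x + 1) * (x ^ 6 - 1)"
    and "x ^ 2 + (x ^ 2 - 1) * (x ^ 3 - 1) < 1 + (x + 1) * (x ^ 4 - 1)"
    and "x ^ 6 + (x ^ 2 - 1) * (x ^ 3 - 1) < 1 + (x + 1) * (x ^ 6 - 1)"
    and "x ^ 4 + (x ^ 2 - 1) * (x ^ 4 - 1) < 1 + (x + 1) * (x ^ 6 - 1)"
    and "x ^ 2 + (x ^ 2 - 1) * (x ^ 5 - 1) < 1 + (x + 1) * (x ^ 6 - 1)"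
    and "1 + (x ^ 2 - 1) * (x ^ 3 - 1) < 1 + (x + 1) * (x ^ 4 - 1)"
    and "1 + (x ^ 2 - 1) * (x ^ 5 - 1) < 1 + (x + 1) * (x ^ 6 - 1)"
    using s s1 x by (unfold d m) linarith+
qed

context alternating_hermitian
begin

text \<open>\<open>x\<close> and \<open>y\<close> are independent modulo the radical, since
  \<open>\<phi>\<close> vanishes on a single line.\<close>

lemma rank_ge_2:
  assumes "\<phi> x y \<noteq> 0"
  obtains r where "2 \<le> r" "vec.dim (radical \<phi>) + r = CARD('n)"
proof -
  have y: "y \<notin> radical \<phi>"
    using assms phi_eq by (auto simp: radical_phi)
  have x: "x \<notin> vec.span (insert y (radical \<phi>))"
  proof
    assume "x \<in> vec.span (insert y (radical \<phi>))"
    then obtain a where "x - a *s y \<in> radical \<phi>"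
      using subspace_radical by (auto simp: vec.span_insert vec.span_eq_iff[THEN iffD2])
    then have "\<phi> (x - a *s y) y = 0"
      by (simp add: radical_on_def)
    moreover have "\<phi> x y = \<phi> (x - a *s y) y + a * \<phi> y y"
      by (simp flip: phi_scale_left phi_add_left del: phi_self)
    ultimately show False
      using assms by simp
  qed
  have "vec.dim (insert x (insert y (radical \<phi>))) = vec.dim (radical \<phi>) + 2"
    using x y subspace_radical by (simp add: vec.dim_insert vec.span_eq_iff[THEN iffD2])
  then have "vec.dim (radical \<phi>) + 2 \<le> CARD('n)"
    by (metis dim_le_card_vec)
  then show ?thesis
    using that[of "CARD('n) - vec.dim (radical \<phi>)"] by simp
qed

text \<open>The radical of the restricted form is the intersection of \<open>radical \<phi>\<close>
  with its orthogonal space, which has dimension \<open>r\<close>.\<close>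

lemma dim_radical_on_radical_le:
  assumes "vec.dim (radical \<phi>) + r = CARD('n)"
  shows "vec.dim (radical_on (radical \<phi>) \<eta>) \<le> r"
    and "vec.dim (radical_on (radical \<phi>) \<eta>) \<le> vec.dim (radical \<phi>)"
proof -
  have "vec.dim (orth \<eta> (radical \<phi>)) = r"
    using dim_orth[OF subspace_radical] assms by simp
  then show "vec.dim (radical_on (radical \<phi>) \<eta>) \<le> r"
    by (metis radical_on_eq inf_le2 vec.dim_subset)
  show "vec.dim (radical_on (radical \<phi>) \<eta>) \<le> vec.dim (radical \<phi>)"
    by (metis radical_on_eq inf_le1 vec.dim_subset)
qed

section \<open>Radical of codimension 2 meeting the Hermitian variety in a cone with vertex of
  dimension 2\<close>

context
  assumes cone: "vec.dim (radical \<phi>) + 2 = CARD('n)" "vec.dim (radical_on (radical \<phi>) \<eta>) = 2"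
begin

text \<open>The image of \<open>adj\<close> is orthogonal to \<open>radical \<phi>\<close>, and by
  dimension that orthogonal space lies inside \<open>radical \<phi>\<close>.\<close>

lemma adj_in_radical: "adj u \<in> radical \<phi> \<inter> orth \<eta> (radical \<phi>)"
proof -
  have "vec.dim (orth \<eta> (radical \<phi>)) = 2"
    using dim_orth[OF subspace_radical] cone by simp
  moreover have "vec.subspace (radical_on (radical \<phi>) \<eta>)"
    by (simp add: radical_on_eq subspace_radical subspace_orth vec.subspace_inter)
  ultimately have "radical_on (radical \<phi>) \<eta> = orth \<eta> (radical \<phi>)"
    using cone(2) vec.subspace_dim_equal[OF _ subspace_orth[of "radical \<phi>"]]
    by (metis radical_on_eq inf_le2 order_refl)
  moreover have "adj u \<in> orth \<eta> (radical \<phi>)"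
    by (simp add: orth_def radical_on_def flip: phi_eq)
  ultimately show ?thesis
    by (simp add: radical_on_eq)
qed

lemma noniso_images_cone: "noniso_images = {}"
  using adj_in_radical by (auto simp: noniso_images_def orth_def)

text \<open>Here \<open>adj\<close> squares to zero, so it has no nonzero eigenvalue and only the
  isotropic vectors of the radical remain.\<close>

lemma card_eigs_cone:
  assumes "even (CARD('n))"
  shows "int q * int (card eigs) =
    int q ^ (2 * vec.dim (radical \<phi>)) + int q ^ (vec.dim (radical \<phi>) + 2) * (int q - 1)"
proof -
  have "eigenspace l = {0}" if "l \<noteq> 0" for l
  proof -
    have "u = 0" if u: "adj u = l *s u" for u
    proof -
      have "adj (adj u) = 0"
        using adj_in_radical by (auto simp: radical_phi)
      then have "l ^ q *s adj u = 0"
        by (metis u adj_scale)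
      with u \<open>l \<noteq> 0\<close> show "u = 0"
        by (simp add: vec.scale_eq_0_iff)
    qed
    then show ?thesis
      using eigenspace_zero by (auto simp: eigenspace_def)
  qed
  then have "int (card eigs) = int (card (isotropics (radical \<phi>)))"
    by (simp add: int_card_eigs)
  moreover have "even (vec.dim (radical \<phi>))"
    using assms by (simp flip: cone(1))
  ultimately show ?thesis
    using card_isotropics[OF subspace_radical] cone(2) by simp
qed

end

lemma card_isotropics_radical_le:
  assumes "vec.dim (radical \<phi>) + r = CARD('n)"
  shows "int (card (isotropics (radical \<phi>))) \<le> int q ^ (2 * (CARD('n) - r))"
proof -
  have "card (isotropics (radical \<phi>)) \<le> card (radical \<phi>)"
    by (rule card_mono) (auto simp: isotropics_def)
  moreover have "CARD('n) - r = vec.dim (radical \<phi>)"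
    using assms by simp
  ultimately show ?thesis
    using card_subspace_q[OF subspace_radical] by (simp flip: of_nat_power)
qed

text \<open>In rank 2 the isotropic vectors of the radical are counted exactly, and a smaller vertex
  costs more than the eigenvectors can make up. In higher rank the size of the radical is a
  sufficient bound.\<close>

lemma card_eigs_less_large:
  assumes k: "CARD('n) = k + 2" "even k" "6 \<le> k"
    and r: "vec.dim (radical \<phi>) + r = CARD('n)" "2 \<le> r"
    and not_cone: "\<not> (r = 2 \<and> vec.dim (radical_on (radical \<phi>) \<eta>) = 2)"
  shows "int q * int (card eigs) < int q ^ (2 * k) + int q ^ (k + 2) * (int q - 1)"
proof (cases "r = 2")
  case True
  let ?t = "vec.dim (radical_on (radical \<phi>) \<eta>)"
  have "?t \<le> 2"
    using dim_radical_on_radical_le(1)[OF r(1)] True by simp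
  then consider "?t = 0" | "?t = 1"
    using not_cone True by linarith
  then have "(- int q) ^ (k + ?t) \<le> int q ^ k"
  proof cases
    case 2
    have "- (int q * int q ^ k) \<le> 0" "0 \<le> int q ^ k" by simp_all
    then have "- (int q * int q ^ k) \<le> int q ^ k" by linarith
    with 2 k(2) show ?thesis by simp
  qed (use k(2) in \<open>simp del: vec.dim_eq_0\<close>)
  then have "int q * int (card (isotropics (radical \<phi>))) \<le> int q ^ (2 * k) + int q ^ k * (int q - 1)"
    using card_isotropics[OF subspace_radical] r True k q_gt_1 by (simp add: mult_right_mono)
  moreover have "int q * int (card eigs) \<le> int q * (int (card (isotropics (radical \<phi>))) + (int q ^ 2 - 1) * (int q ^ 2 - 1))"
    using card_eigs_le_rank[OF r(1)] True by (intro mult_left_mono) auto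
  ultimately have "int q * int (card eigs) \<le>
      int q ^ (2 * k) + int q ^ k * (int q - 1) + int q * ((int q ^ 2 - 1) * (int q ^ 2 - 1))"
    by (simp add: distrib_left)
  \<comment> \<open>The right-hand side is the gap between the cone value and the bound for a
    smaller vertex; the left-hand side bounds the eigenvectors.\<close>
  also have "int q * ((int q ^ 2 - 1) * (int q ^ 2 - 1)) < int q ^ k * (int q - 1) * (int q ^ 2 - 1)"
  proof -
    have "int q * (int q + 1) < int q ^ k"
    proof -
      have "int q * (int q + 1) < int q * (int q * int q)"
      proof (rule mult_strict_left_mono)
        have "2 * int q \<le> int q * int q"
          using q_gt_1 by (intro mult_right_mono) auto
        then show "int q + 1 < int q * int q"
          using q_gt_1 by linarith
      qed (use q_gt_1 in simp)
      also have "\<dots> = int q ^ 3"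
        by (simp add: power3_eq_cube)
      also have "\<dots> \<le> int q ^ k"
        using q_gt_1 k(3) by (intro power_increasing) auto
      finally show ?thesis .
    qed
    moreover have "0 < int q - 1" "0 < int q ^ 2 - 1"
      using q_gt_1 by simp_all
    ultimately have "int q * (int q + 1) * ((int q - 1) * (int q ^ 2 - 1)) < int q ^ k * ((int q - 1) * (int q ^ 2 - 1))"
      by (intro mult_strict_right_mono) auto
    moreover have "int q ^ 2 - 1 = (int q + 1) * (int q - 1)"
      by (simp add: power2_eq_square algebra_simps)
    ultimately show ?thesis
      by (simp add: mult.assoc mult.left_commute)
  qed
  finally show ?thesis
    by (simp add: power_add power2_eq_square algebra_simps)
next
  case False
  then have r3: "3 \<le> r" and rk: "r \<le> k + 2"
    using r k by linarith+
  have "int (card (isotropics (radical \<phi>))) \<le> int q ^ (2 * k - 2)"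
  proof -
    have "int (card (isotropics (radical \<phi>))) \<le> int q ^ (2 * (CARD('n) - r))"
      by (rule card_isotropics_radical_le[OF r(1)])
    also have "\<dots> \<le> int q ^ (2 * k - 2)"
      using r3 k q_gt_1 by (intro power_increasing) auto
    finally show ?thesis .
  qed
  moreover have "(int q ^ 2 - 1) * (int q ^ r - 1) \<le> (int q ^ 2 - 1) * int q ^ (k + 2)"
  proof (rule mult_left_mono)
    have "int q ^ r \<le> int q ^ (k + 2)"
      using rk q_gt_1 by (intro power_increasing) auto
    then show "int q ^ r - 1 \<le> int q ^ (k + 2)" by simp
  qed (use q_gt_1 in simp)
  ultimately have "int (card eigs) \<le> int q ^ (2 * k - 2) + (int q ^ 2 - 1) * int q ^ (k + 2)"
    using card_eigs_le_rank[OF r(1)] by linarith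
  also have "\<dots> \<le> int q ^ (2 * k - 2) + int q ^ (k + 4) - int q ^ (k + 2)"
    by (simp add: power_add power2_eq_square power4_eq_xxxx algebra_simps)
  \<comment> \<open>This is where \<open>6 \<le> k\<close> is decisive: it is equivalent to
    \<open>k + 4 \<le> 2 * k - 2\<close>.\<close>
  also have "int q ^ (k + 4) \<le> int q ^ (2 * k - 2)"
    using k(3) q_gt_1 by (intro power_increasing) auto
  finally have "int q * int (card eigs) \<le> int q * (2 * int q ^ (2 * k - 2) - int q ^ (k + 2))"
    using q_gt_1 by (intro mult_left_mono) auto
  also have "\<dots> \<le> int q * (int q * int q ^ (2 * k - 2) - int q ^ (k + 2))"
    using q_gt_1 by (intro mult_left_mono diff_right_mono mult_right_mono) auto
  also have "\<dots> = int q ^ (2 * k) - int q ^ (k + 3)"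
  proof -
    have "2 * k = Suc (Suc (2 * k - 2))"
      using k(3) by simp
    then have "int q ^ (2 * k) = int q * (int q * int q ^ (2 * k - 2))"
      by (metis power_Suc)
    then show ?thesis
      by (simp add: right_diff_distrib power_add power3_eq_cube power2_eq_square)
  qed
  also have "\<dots> < int q ^ (2 * k) + int q ^ (k + 2) * (int q - 1)"
  proof -
    have "0 < int q ^ (k + 3)" "0 < int q ^ (k + 2) * (int q - 1)"
      using q_gt_1 by simp_all
    then show ?thesis by linarith
  qed
  finally show ?thesis .
qed

text \<open>Split by rank. Rank 2 includes the cones, which have to be beaten as well; intermediate
  ranks use the size of the radical; full rank uses the non-scalar bound.\<close>

lemma card_eigs_less_small:
  assumes k: "CARD('n) = k + 2" "k = 2 \<or> k = 4"
    and r: "vec.dim (radical \<phi>) + r = CARD('n)" "2 \<le> r"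
    and nonscalar: "\<And>c. c \<noteq> 0 \<Longrightarrow> \<exists>u. adj (adj u) \<noteq> c *s u"
  shows "int (card eigs) < 1 + (int q + 1) * (int q ^ (k + 2) - 1)"
proof -
  have q2: "2 \<le> int q"
    using q_gt_1 by simp
  let ?E = "int (card eigs)" and ?q = "int q"
  consider "r = 2" | "3 \<le> r" "r < k + 2" | "r = k + 2"
    using r k by linarith
  then show ?thesis
  proof cases
    case 1
    let ?t = "vec.dim (radical_on (radical \<phi>) \<eta>)"
    have t: "?t \<le> 2"
      using dim_radical_on_radical_le(1)[OF r(1)] 1 by simp
    have "(- ?q) ^ (k + ?t) \<le> \<bar>(- ?q) ^ (k + ?t)\<bar>" by (rule abs_ge_self)
    also have "\<dots> = ?q ^ (k + ?t)"
      by (simp add: power_abs)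
    also have "\<dots> \<le> ?q ^ (k + 2)"
      using t q_gt_1 by (intro power_increasing) auto
    finally have "?q * int (card (isotropics (radical \<phi>))) \<le> ?q ^ (2 * k) + ?q ^ (k + 2) * (?q - 1)"
      using card_isotropics[OF subspace_radical] r 1 k(1) q_gt_1 by (simp add: mult_right_mono)
    also have "\<dots> = ?q * (?q ^ (2 * k - 1) + ?q ^ (k + 1) * (?q - 1))"
      using k(2) by (auto simp: algebra_simps eval_nat_numeral)
    finally have "int (card (isotropics (radical \<phi>))) \<le> ?q ^ (2 * k - 1) + ?q ^ (k + 1) * (?q - 1)"
      using q_gt_1 by simp
    then have "?E \<le> ?q ^ (2 * k - 1) + ?q ^ (k + 1) * (?q - 1) + (?q ^ 2 - 1) * (?q ^ 2 - 1)"
      using card_eigs_le_rank[OF r(1)] 1 by simp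
    also have "\<dots> < 1 + (?q + 1) * (?q ^ (k + 2) - 1)"
      using k(2) rank_bounds_strict[OF q2] by (elim disjE) simp_all
    finally show ?thesis .
  next
    case 2
    then have rk: "k = 2 \<and> r = 3 \<or> k = 4 \<and> r = 3 \<or> k = 4 \<and> r = 4 \<or> k = 4 \<and> r = 5"
      using k(2) by linarith
    have "?E \<le> ?q ^ (2 * (k + 2 - r)) + (?q ^ 2 - 1) * (?q ^ r - 1)"
      using card_eigs_le_rank[OF r(1)] card_isotropics_radical_le[OF r(1)] unfolding k(1) by linarith
    also have "\<dots> < 1 + (?q + 1) * (?q ^ (k + 2) - 1)"
      using rk rank_bounds_strict[OF q2] by (elim disjE conjE) simp_all
    finally show ?thesis .
  next
    case 3
    \<comment> \<open>The radical now contributes only the zero vector, the summand 1 below.\<close>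
    then have "radical \<phi> = {0}"
      using r(1) k(1) subspace_radical vec.subspace_0 by (metis add_cancel_left_left subset_singletonD empty_iff vec.dim_eq_0)
    then have "?E \<le> 1 + (?q ^ 2 - 1) * (?q ^ (k + 1) - 1)"
      using card_eigs_le_nonscalar[OF nonscalar] k(1) by (simp add: isotropics_zero)
    also have "\<dots> < 1 + (?q + 1) * (?q ^ (k + 2) - 1)"
      using k(2) rank_bounds_strict[OF q2] by (elim disjE) simp_all
    finally show ?thesis .
  qed
qed

end

section \<open>Lines and codewords\<close>

lemma wedge_add_left: "wedge (u + v) w = wedge u w + wedge v w"
  and wedge_add_right: "wedge w (u + v) = wedge w u + wedge w v"
  by (transfer, unfold ext2_eq_def diff_diff_eq[symmetric], rule free.span_base,
      unfold ext2_relators_def, blast)+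

lemma wedge_scale_left: "wedge (a *s u) v = ext2_scale a (wedge u v)"
  and wedge_scale_right: "wedge u (a *s v) = ext2_scale a (wedge u v)"
  by (transfer, unfold ext2_eq_def, rule free.span_base, unfold ext2_relators_def, blast)+

lemma wedge_self: "wedge u u = 0"
  by (transfer, unfold ext2_eq_def diff_zero, rule free.span_base, unfold ext2_relators_def, blast)

lemma wedge_swap: "wedge v u = - wedge u v"
proof -
  have "wedge (u + v) (u + v) = 0"
    by (rule wedge_self)
  then show ?thesis
    by (simp add: wedge_add_left wedge_add_right wedge_self[of u] wedge_self[of v]
        eq_neg_iff_add_eq_0 add.commute)
qed

text \<open>The factor is the determinant of the coordinates of \<open>u\<close> and
  \<open>v\<close> with respect to \<open>a\<close> and \<open>b\<close>.\<close>

lemma wedge_in_span_wedge: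
  assumes "u \<in> vec.span {a, b}" "v \<in> vec.span {a, b}"
  shows "wedge u v \<in> ext2.span {wedge a b}"
proof -
  obtain c d e f where uv: "u = c *s a + d *s b" "v = e *s a + f *s b"
    using assms by (auto simp: in_span_pair)
  have "wedge u v = ext2_scale (c * f - d * e) (wedge a b)"
    unfolding uv wedge_add_left wedge_add_right wedge_scale_left wedge_scale_right wedge_self wedge_swap[of b a]
    by (simp add: ext2.scale_left_diff_distrib mult.commute)
  then show ?thesis
    by (simp add: ext2.span_base ext2.span_scale)
qed

lemma span_singleton_eqI: "x \<in> ext2.span {y} \<Longrightarrow> y \<in> ext2.span {x} \<Longrightarrow> ext2.span {x} = ext2.span {y}"
  by (intro subset_antisym ext2.span_minimal) auto

lemma ext2_functional_in_span:
  assumes "alternating_form \<phi>" "x \<in> ext2.span {y}" "ext2_functional \<phi> y = 0"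
  shows "ext2_functional \<phi> x = 0"
proof -
  interpret f: Vector_Spaces.linear ext2_scale "(*)" "ext2_functional \<phi>"
    by (rule linear_ext2_functional[OF assms(1)])
  show ?thesis
    using assms(2,3) by (auto simp: ext2.span_singleton f.scale)
qed

lemma span_pair_eq_of_dim_2:
  assumes "vec.dim (vec.span {a, b}) = 2" "u \<in> vec.span {a, b}" "v \<in> vec.span {a, b}"
    "u \<noteq> 0" "v \<notin> vec.span {u}"
  shows "vec.span {u, v} = vec.span {a, b}"
proof (rule vec.subspace_dim_equal)
  show "vec.span {u, v} \<subseteq> vec.span {a, b}"
    using assms(2,3) by (intro vec.span_minimal) auto
  show "vec.dim (vec.span {a, b}) \<le> vec.dim (vec.span {u, v})"
    unfolding assms(1) using assms(4,5) by (simp only: dim_span_pair if_False order_refl)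
qed auto

context hermitian_space
begin

text \<open>The wedge product of two functionals given by \<open>\<eta>\<close>; all alternating
  forms constructed below are built from such products.\<close>

lemma alternating_form_eta_wedge: "alternating_form (\<lambda>x y. \<eta> x a * \<eta> y b - \<eta> x b * \<eta> y a)"
  unfolding alternating_form_def Vector_Spaces.linear_iff
  by (auto simp: algebra_simps vector_space_over_itself.vector_space_axioms vec.vector_space_axioms)

text \<open>Take \<open>y\<close> orthogonal to \<open>a\<close> and \<open>b\<close> but not to
  \<open>u\<close>, and \<open>z\<close> orthogonal to \<open>u\<close> but not to \<open>v\<close>.
  On \<open>(u, v)\<close> the wedge of the two functionals then reduces to a product of nonzero
  values.\<close>

lemma ex_alternating_separating:
  fixes u v a b :: "'k ^ 'n"
  assumes u: "u \<notin> vec.span {a, b}" "v \<notin> vec.span {u}"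
  shows "\<exists>\<psi>. alternating_form \<psi> \<and> \<psi> a b = 0 \<and> \<psi> u v \<noteq> 0"
proof -
  have separate: "\<exists>y\<in>orth \<eta> S. \<eta> x y \<noteq> 0" if "x \<notin> vec.span S" for x S
    using that orth_orth[OF vec.subspace_span, of S] unfolding orth_span mem_orth[of x]
    by (metis mem_orth)
  obtain y where y: "y \<in> orth \<eta> {a, b}" "\<eta> u y \<noteq> 0"
    using separate[OF u(1)] by blast
  obtain z where z: "z \<in> orth \<eta> {u}" "\<eta> v z \<noteq> 0"
    using separate[OF u(2)] by blast
  show ?thesis
    by (rule exI[of _ "\<lambda>x x'. \<eta> x y * \<eta> x' z - \<eta> x z * \<eta> x' y"])
      (use y z alternating_form_eta_wedge in \<open>auto simp: orth_def\<close>)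
qed

text \<open>Injectivity of the Plucker embedding, obtained by testing with functionals that vanish
  on \<open>wedge a b\<close>.\<close>

lemma wedge_in_span_wedgeD:
  fixes u v a b :: "'k ^ 'n"
  assumes w: "wedge u v \<in> ext2.span {wedge a b}" and uv: "u \<noteq> 0" "v \<notin> vec.span {u}"
  shows "u \<in> vec.span {a, b}" "v \<in> vec.span {a, b}"
proof -
  have *: "\<psi> u v = 0" if "alternating_form \<psi>" "\<psi> a b = 0" for \<psi>
    using ext2_functional_in_span[OF that(1) w] that by (simp add: ext2_functional_wedge)
  show "u \<in> vec.span {a, b}"
    using ex_alternating_separating[of u a b v] uv * by blast
  have "u \<notin> vec.span {v}"
  proof
    assume "u \<in> vec.span {v}"
    then obtain c where c: "u = c *s v"
      by (auto simp: in_span_singleton)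
    with uv have "v = inverse c *s u"
      by (auto simp: vec.scale_eq_0_iff)
    then show False
      using uv by (metis in_span_singleton)
  qed
  show "v \<in> vec.span {a, b}"
  proof (rule ccontr)
    assume "v \<notin> vec.span {a, b}"
    then obtain \<psi> where psi: "alternating_form \<psi>" "\<psi> a b = 0" "\<psi> v u \<noteq> 0"
      using ex_alternating_separating[of v a b u] \<open>u \<notin> vec.span {v}\<close> by blast
    interpret \<psi>: alternating_hermitian q \<eta> \<psi>
      by unfold_locales (rule psi)
    show False
      using *[OF psi(1,2)] psi(3) \<psi>.phi_swap[of v u] by simp
  qed
qed

end

context alternating_hermitian
begin

text \<open>On a line where \<open>\<phi>\<close> is nonzero, the pairs counted are exactly the
  ordered bases of that line.\<close>

lemma card_nonzero_pairs:
  assumes dim: "vec.dim (vec.span {a, b}) = 2" and ab: "\<phi> a b \<noteq> 0"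
  shows "card {(u, v). u \<in> vec.span {a, b} \<and> v \<in> vec.span {a, b} \<and> \<phi> v u \<noteq> 0} = (q ^ 4 - 1) * (q ^ 4 - q ^ 2)"
proof -
  let ?L = "vec.span {a, b}"
  have iff: "\<phi> v u \<noteq> 0 \<longleftrightarrow> v \<notin> vec.span {u}" if uv: "u \<in> ?L" "v \<in> ?L" "u \<noteq> 0" for u v
  proof
    show "\<phi> v u \<noteq> 0 \<Longrightarrow> v \<notin> vec.span {u}"
      by (auto simp: in_span_singleton)
    assume "v \<notin> vec.span {u}"
    then have eq: "vec.span {u, v} = ?L"
      using uv by (intro span_pair_eq_of_dim_2 dim)
    have "a \<in> vec.span {u, v}" "b \<in> vec.span {u, v}"
      unfolding eq by (auto intro: vec.span_base)
    then obtain c d e f where "a = c *s u + d *s v" "b = e *s u + f *s v"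
      by (auto simp: in_span_pair)
    then show "\<phi> v u \<noteq> 0"
      using ab phi_swap[of v u] by auto
  qed
  have "{(u, v). u \<in> ?L \<and> v \<in> ?L \<and> \<phi> v u \<noteq> 0} = (SIGMA u:?L - {0}. ?L - vec.span {u})"
    using iff by fastforce
  then have "card {(u, v). u \<in> ?L \<and> v \<in> ?L \<and> \<phi> v u \<noteq> 0} = (\<Sum>u\<in>?L - {0}. card (?L - vec.span {u}))"
    by (simp add: card_SigmaI)
  also have "\<dots> = (\<Sum>u\<in>?L - {0}. q ^ 4 - q ^ 2)"
  proof (intro sum.cong refl)
    fix u assume u: "u \<in> ?L - {0}"
    then have "vec.span {u} \<subseteq> ?L"
      by (intro vec.span_minimal) auto
    moreover have "card (vec.span {u}) = q ^ 2"
      using u card_subspace_q[OF vec.subspace_span, of "{u}"] by simp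
    ultimately show "card (?L - vec.span {u}) = q ^ 4 - q ^ 2"
      using card_subspace_q[OF vec.subspace_span, of "{a, b}"] dim by (simp add: card_Diff_subset)
  qed
  also have "\<dots> = (q ^ 4 - 1) * (q ^ 4 - q ^ 2)"
    using card_subspace_q[OF vec.subspace_span, of "{a, b}"] dim
    by (simp add: card_Diff_singleton vec.span_zero)
  finally show ?thesis .
qed

text \<open>The pairs are partitioned by the line they span; each nonzero coordinate of the codeword
  accounts for the ordered bases of one line.\<close>

theorem card_phi_pairs_eq_weight:
  assumes "point_representatives \<omega>s (line_hermitian_grassmannian \<eta>)"
  shows "card phi_pairs = hamming_weight (codeword \<omega>s \<phi>) * ((q ^ 4 - 1) * (q ^ 4 - q ^ 2))"
proof -
  let ?P = "\<lambda>i a b. ext2.span {\<omega>s ! i} = ext2.span {wedge a b} \<and> vec.dim (vec.span {a, b}) = 2 \<and>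
    totally_isotropic \<eta> (vec.span {a, b})"
  have dist: "distinct (map (\<lambda>\<omega>. ext2.span {\<omega>}) \<omega>s)"
    and set: "set (map (\<lambda>\<omega>. ext2.span {\<omega>}) \<omega>s) = line_hermitian_grassmannian \<eta>"
    using assms by (auto simp: point_representatives_def)
  have "\<exists>a b. ?P i a b" if "i < length \<omega>s" for i
  proof -
    have "ext2.span {\<omega>s ! i} \<in> line_hermitian_grassmannian \<eta>"
      unfolding set[symmetric] using that by auto
    then show ?thesis
      unfolding line_hermitian_grassmannian_def by blast
  qed
  then obtain a b where ab: "\<And>i. i < length \<omega>s \<Longrightarrow> ?P i (a i) (b i)"
    by metis
  let ?L = "\<lambda>i. vec.span {a i, b i}"
  let ?F = "\<lambda>i. {(u, v). u \<in> ?L i \<and> v \<in> ?L i \<and> \<phi> v u \<noteq> 0}"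
  let ?I = "{i. i < length (codeword \<omega>s \<phi>) \<and> codeword \<omega>s \<phi> ! i \<noteq> 0}"
  \<comment> \<open>The chosen representative and the wedge span the same point, so vanishing does
    not depend on the choice.\<close>
  have nz: "ext2_functional \<phi> (\<omega>s ! i) \<noteq> 0 \<longleftrightarrow> \<phi> (a i) (b i) \<noteq> 0" if "i < length \<omega>s" for i
    using ab[OF that] ext2_functional_in_span[OF alternating] ext2_functional_wedge[OF alternating]
    by (metis ext2.span_base singletonI)
  have indep: "u \<noteq> 0" "v \<notin> vec.span {u}" if "\<phi> v u \<noteq> 0" for u v
    using that by (auto simp: in_span_singleton)
  have "phi_pairs = (\<Union>i\<in>?I. ?F i)"
  proof
    show "(\<Union>i\<in>?I. ?F i) \<subseteq> phi_pairs"
      using ab by (fastforce simp: codeword_def phi_pairs_def totally_isotropic_def)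
    show "phi_pairs \<subseteq> (\<Union>i\<in>?I. ?F i)"
    proof clarify
      fix u v assume "(u, v) \<in> phi_pairs"
      then have uv: "\<eta> u u = 0" "\<eta> v v = 0" "\<eta> v u = 0" "\<eta> u v = 0" and nz': "\<phi> v u \<noteq> 0"
        using sym_zero by (auto simp: phi_pairs_def)
      note ind = indep[OF nz']
      have "totally_isotropic \<eta> (vec.span {u, v})"
        using uv by (auto simp: totally_isotropic_def in_span_pair)
      moreover have "vec.dim (vec.span {u, v}) = 2"
        using ind by (simp only: dim_span_pair if_False)
      ultimately have "ext2.span {wedge u v} \<in> line_hermitian_grassmannian \<eta>"
        unfolding line_hermitian_grassmannian_def by blast
      then obtain i where i: "i < length \<omega>s" "ext2.span {\<omega>s ! i} = ext2.span {wedge u v}"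
        unfolding set[symmetric] by (auto simp: in_set_conv_nth)
      then have w: "wedge u v \<in> ext2.span {wedge (a i) (b i)}"
        using ab[OF i(1)] by (metis ext2.span_base singletonI)
      have "u \<in> ?L i" "v \<in> ?L i"
        using wedge_in_span_wedgeD[OF w ind] by auto
      moreover have "\<phi> (a i) (b i) \<noteq> 0"
        using ext2_functional_in_span[OF alternating w] nz' phi_swap[of v u]
        by (auto simp: ext2_functional_wedge[OF alternating])
      ultimately show "(u, v) \<in> (\<Union>i\<in>?I. ?F i)"
        using i nz nz' by (auto simp: codeword_def)
    qed
  qed
  \<comment> \<open>A common pair spans both lines, so the two points coincide, against distinctness
    of the list.\<close>
  moreover have "?F i \<inter> ?F j = {}" if "i \<in> ?I" "j \<in> ?I" "i \<noteq> j" for i j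
  proof (rule ccontr)
    assume "?F i \<inter> ?F j \<noteq> {}"
    then obtain u v where uv: "u \<in> ?L i" "v \<in> ?L i" "u \<in> ?L j" "v \<in> ?L j" "\<phi> v u \<noteq> 0"
      by blast
    have ij: "i < length \<omega>s" "j < length \<omega>s"
      using that by (auto simp: codeword_def)
    note ind = indep[OF uv(5)]
    have eq: "vec.span {u, v} = ?L i" "vec.span {u, v} = ?L j"
      by (intro span_pair_eq_of_dim_2 uv ind, use ab ij in blast)+
    then have "a i \<in> ?L j" "b i \<in> ?L j" "a j \<in> ?L i" "b j \<in> ?L i"
      by (metis insertCI vec.span_base)+
    then have "ext2.span {wedge (a i) (b i)} = ext2.span {wedge (a j) (b j)}"
      by (intro span_singleton_eqI wedge_in_span_wedge)
    then have "ext2.span {\<omega>s ! i} = ext2.span {\<omega>s ! j}"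
      using ab[OF ij(1)] ab[OF ij(2)] by simp
    then show False
      using dist ij \<open>i \<noteq> j\<close> by (auto simp: distinct_conv_nth)
  qed
  ultimately have "card phi_pairs = (\<Sum>i\<in>?I. card (?F i))"
    by (simp only:) (intro card_UN_disjoint; simp)
  also have "\<dots> = (\<Sum>i\<in>?I. (q ^ 4 - 1) * (q ^ 4 - q ^ 2))"
    using ab nz by (intro sum.cong refl card_nonzero_pairs) (auto simp: codeword_def)
  finally show ?thesis
    by (simp add: hamming_weight_def)
qed

end

section \<open>Minimum weight codewords\<close>

lemma alternating_form_sum:
  assumes "\<And>i. i \<in> I \<Longrightarrow> alternating_form (f i)"
  shows "alternating_form (\<lambda>x y. \<Sum>i\<in>I. f i x y)"
  using assms
  by (simp add: alternating_form_def Vector_Spaces.linear_iff sum.distrib sum_distrib_left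
      vector_space_over_itself.vector_space_axioms vec.vector_space_axioms)

lemma sum_lessThan_double: "(\<Sum>j<2 * h. g j) = (\<Sum>i<h. g (2 * i) + g (2 * i + 1))"
  for g :: "nat \<Rightarrow> 'b::comm_monoid_add"
  by (induction h) (auto simp: ac_simps)

lemma hamming_weight_eq_0: "hamming_weight c = 0 \<longleftrightarrow> c = replicate (length c) 0"
  by (auto simp: hamming_weight_def list_eq_iff_nth_eq)

context hermitian_space
begin

section \<open>Orthonormal bases and existence of extremal forms\<close>

definition orthonormal :: "('k ^ 'n) set \<Rightarrow> bool" where
  "orthonormal S \<longleftrightarrow> (\<forall>v\<in>S. \<forall>w\<in>S. \<eta> v w = (if v = w then 1 else 0))"

lemma orthonormal_residual:
  assumes "orthonormal S"
  shows "u - (\<Sum>v\<in>S. \<eta> u v *s v) \<in> orth \<eta> S"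
proof -
  have "\<eta> (\<Sum>v\<in>S. \<eta> u v *s v) w = \<eta> u w" if "w \<in> S" for w
  proof -
    have "\<eta> (\<Sum>v\<in>S. \<eta> u v *s v) w = (\<Sum>v\<in>S. \<eta> u v * \<eta> v w)"
      by (simp add: sum_left)
    also have "\<dots> = (\<Sum>v\<in>S. if v = w then \<eta> u v else 0)"
      using assms that by (intro sum.cong) (auto simp: orthonormal_def)
    finally show ?thesis
      using that by simp
  qed
  then show ?thesis
    by (simp add: mem_orth)
qed

text \<open>Gram-Schmidt: the orthogonal space of \<open>S\<close> is nonzero by dimension and
  contains a non-isotropic vector, which is normalised by surjectivity of the norm.\<close>

lemma ex_orthonormal:
  assumes "k \<le> CARD('n)"
  shows "\<exists>S. card S = k \<and> orthonormal S"
  using assms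
proof (induction k)
  case 0
  then show ?case
    by (intro exI[of _ "{}"]) (simp add: orthonormal_def)
next
  case (Suc k)
  then obtain S where S: "card S = k" "orthonormal S"
    by auto
  let ?U = "orth \<eta> S"
  have "vec.dim ?U \<noteq> 0"
    using dim_orth_ge[of S, OF finite] S(1) Suc.prems by linarith
  then obtain x where x: "x \<in> ?U" "x \<noteq> 0"
    by auto
  \<comment> \<open>Otherwise \<open>x\<close> is orthogonal to \<open>?U\<close> and to
    \<open>S\<close>, which together span, contradicting non-degeneracy.\<close>
  have "\<exists>z\<in>?U. \<eta> z z \<noteq> 0"
  proof (rule ccontr)
    assume "\<not> ?thesis"
    then have iso: "\<eta> x y = 0" if "y \<in> ?U" for y
      using totally_isotropic_if_isotropic[OF subspace_orth] x that by blast
    have "\<eta> x y = 0" for y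
    proof -
      have "\<eta> x (y - (\<Sum>v\<in>S. \<eta> y v *s v)) = 0"
        by (intro iso orthonormal_residual S)
      then show ?thesis
        using x(1) by (simp add: sum_right mem_orth)
    qed
    then show False
      using nondegD x(2) by blast
  qed
  then obtain z where z: "z \<in> ?U" "\<eta> z z \<noteq> 0"
    by blast
  have "inverse (\<eta> z z) ^ q = inverse (\<eta> z z)"
    using conj[of z z] by (simp add: power_inverse)
  then obtain a where a: "a ^ (q + 1) = inverse (\<eta> z z)"
    using norm_surj by blast
  let ?w = "a *s z"
  have w: "\<eta> ?w ?w = 1"
  proof -
    have "\<eta> ?w ?w = a ^ (q + 1) * \<eta> z z"
      by (simp add: algebra_simps)
    then show ?thesis
      unfolding a using z(2) by simp
  qed
  have orth: "\<eta> ?w v = 0" "\<eta> v ?w = 0" if "v \<in> S" for v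
    using z(1) that by (auto simp: mem_orth sym_zero[of v])
  have "?w \<notin> S"
    using w orth by force
  then have "card (insert ?w S) = Suc k"
    using S by simp
  moreover have "orthonormal (insert ?w S)"
    using S(2) w orth by (auto simp: orthonormal_def simp del: scale_left scale_right)
  ultimately show ?case by blast
qed

lemma orthonormal_expansion:
  assumes "orthonormal S" "card S = CARD('n)"
  shows "(\<Sum>v\<in>S. \<eta> u v *s v) = u"
proof -
  have "vec.independent S"
  proof (subst vec.independent_explicit_finite_subsets, intro allI impI ballI)
    fix A c v assume A: "A \<subseteq> S" "finite A" "(\<Sum>v\<in>A. c v *s v) = 0" and v: "v \<in> A"
    have "0 = \<eta> (\<Sum>v\<in>A. c v *s v) v"
      using A(3) by simp
    also have "\<dots> = (\<Sum>w\<in>A. c w * \<eta> w v)"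
      by (simp add: sum_left)
    also have "\<dots> = (\<Sum>w\<in>A. if w = v then c w else 0)"
      using assms(1) A v by (intro sum.cong) (auto simp: orthonormal_def subset_iff)
    finally show "c v = 0"
      using A v by simp
  qed
  then have "UNIV \<subseteq> vec.span S"
    using assms(2) by (intro vec.card_ge_dim_independent) (auto simp: card_cart_basis)
  then have "orth \<eta> S = {0}"
    using orth_UNIV orth_span by (metis top.extremum_uniqueI)
  then show ?thesis
    using orthonormal_residual[OF assms(1), of u] by simp
qed

lemma ex_orthonormal_basis:
  obtains b where "\<And>i j. i < CARD('n) \<Longrightarrow> j < CARD('n) \<Longrightarrow> \<eta> (b i) (b j) = (if i = j then 1 else 0)"
    and "\<And>u. (\<Sum>i<CARD('n). \<eta> u (b i) *s b i) = u"
proof -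
  obtain S where S: "card S = CARD('n)" "orthonormal S"
    using ex_orthonormal by blast
  obtain b where b: "bij_betw b {..<CARD('n)} S"
    using ex_bij_betw_nat_finite[of S] S(1) by (auto simp: atLeast0LessThan)
  show ?thesis
  proof (rule that)
    show "\<eta> (b i) (b j) = (if i = j then 1 else 0)" if "i < CARD('n)" "j < CARD('n)" for i j
      using b S(2) that by (auto simp: bij_betw_def orthonormal_def inj_on_def)
    show "(\<Sum>i<CARD('n). \<eta> u (b i) *s b i) = u" for u
      using sum.reindex_bij_betw[OF b, of "\<lambda>v. \<eta> u v *s v"] orthonormal_expansion[OF S(2,1)] by simp
  qed
qed

text \<open>The standard symplectic form pairing consecutive vectors of an orthonormal basis; its
  map squares to \<open>- 1\<close>.\<close>

lemma ex_scalar_alternating_form: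
  assumes "even (CARD('n))"
  shows "\<exists>\<phi>. alternating_form \<phi> \<and> (\<exists>c. c \<noteq> 0 \<and> (\<forall>u. alternating_hermitian.adj \<eta> \<phi> (alternating_hermitian.adj \<eta> \<phi> u) = c *s u))"
proof -
  obtain h where h: "CARD('n) = 2 * h"
    using assms by blast
  obtain b where on: "\<And>i j. i < CARD('n) \<Longrightarrow> j < CARD('n) \<Longrightarrow> \<eta> (b i) (b j) = (if i = j then 1 else 0)"
    and ex: "\<And>u. (\<Sum>i<CARD('n). \<eta> u (b i) *s b i) = u"
    by (rule ex_orthonormal_basis) blast
  define \<phi> where "\<phi> x y = (\<Sum>i<h. \<eta> x (b (2 * i)) * \<eta> y (b (2 * i + 1)) - \<eta> x (b (2 * i + 1)) * \<eta> y (b (2 * i)))" for x y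
  have alt: "alternating_form \<phi>"
    unfolding \<phi>_def[abs_def] by (intro alternating_form_sum alternating_form_eta_wedge)
  interpret alternating_hermitian q \<eta> \<phi>
    by unfold_locales (rule alt)
  have even_coord: "\<phi> (b (2 * i)) u = \<eta> u (b (2 * i + 1))"
    and odd_coord: "\<phi> (b (2 * i + 1)) u = - \<eta> u (b (2 * i))" if "i < h" for i u
  proof -
    have on': "\<eta> (b (2 * i)) (b (2 * j)) = (if j = i then 1 else 0)" "\<eta> (b (2 * i)) (b (2 * j + 1)) = 0"
      "\<eta> (b (2 * i + 1)) (b (2 * j)) = 0" "\<eta> (b (2 * i + 1)) (b (2 * j + 1)) = (if j = i then 1 else 0)"
      if "j < h" for j
    proof -
      have "2 * i \<noteq> 2 * j + 1" "2 * i + 1 \<noteq> 2 * j" by presburger+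
      then show "\<eta> (b (2 * i)) (b (2 * j)) = (if j = i then 1 else 0)" "\<eta> (b (2 * i)) (b (2 * j + 1)) = 0"
        "\<eta> (b (2 * i + 1)) (b (2 * j)) = 0" "\<eta> (b (2 * i + 1)) (b (2 * j + 1)) = (if j = i then 1 else 0)"
        using \<open>i < h\<close> \<open>j < h\<close> h by (subst on; force)+
    qed
    have "\<phi> (b (2 * i)) u = (\<Sum>j<h. if j = i then \<eta> u (b (2 * j + 1)) else 0)"
      unfolding \<phi>_def by (intro sum.cong refl) (simp add: on'[simplified])
    then show "\<phi> (b (2 * i)) u = \<eta> u (b (2 * i + 1))"
      using that by simp
    have "\<phi> (b (2 * i + 1)) u = (\<Sum>j<h. if j = i then - \<eta> u (b (2 * j)) else 0)"
      unfolding \<phi>_def by (intro sum.cong refl) (simp add: on'[simplified])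
    then show "\<phi> (b (2 * i + 1)) u = - \<eta> u (b (2 * i))"
      using that by simp
  qed
  have "adj (adj u) = (- 1) *s u" for u
  proof (rule adj_eqI)
    fix y
    have coord: "\<eta> (adj u) (b j) = \<phi> (b j) u ^ q" for j
      using conj[of "adj u" "b j"] by (simp add: phi_eq)
    have "\<phi> y (adj u) = (\<Sum>i<h. - (\<eta> y (b (2 * i)) * \<eta> (b (2 * i)) u + \<eta> y (b (2 * i + 1)) * \<eta> (b (2 * i + 1)) u))"
      unfolding \<phi>_def[of y] coord
    proof (intro sum.cong refl)
      fix i assume "i \<in> {..<h}"
      then have i: "i < h" by simp
      have "\<phi> (b (2 * i)) u ^ q = \<eta> (b (2 * i + 1)) u" "\<phi> (b (2 * i + 1)) u ^ q = - \<eta> (b (2 * i)) u"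
        unfolding even_coord[OF i] odd_coord[OF i] frob_minus by (simp_all flip: conj)
      then show "\<eta> y (b (2 * i)) * \<phi> (b (2 * i + 1)) u ^ q - \<eta> y (b (2 * i + 1)) * \<phi> (b (2 * i)) u ^ q =
         - (\<eta> y (b (2 * i)) * \<eta> (b (2 * i)) u + \<eta> y (b (2 * i + 1)) * \<eta> (b (2 * i + 1)) u)"
        by simp
    qed
    \<comment> \<open>Even and odd positions together run through the whole basis, so the
      orthonormal expansion of \<open>y\<close> appears.\<close>
    also have "\<dots> = - (\<Sum>j<CARD('n). \<eta> y (b j) * \<eta> (b j) u)"
      unfolding h sum_lessThan_double by (rule sum_negf)
    also have "\<dots> = - \<eta> (\<Sum>j<CARD('n). \<eta> y (b j) *s b j) u"
      by (simp add: sum_left)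
    also have "\<dots> = \<eta> y ((- 1) *s u)"
      unfolding ex by simp
    finally show "\<phi> y (adj u) = \<eta> y ((- 1) *s u)" .
  qed
  with alt show ?thesis
    by (intro exI[of _ \<phi>] conjI exI[of _ "- 1"]) auto
qed

text \<open>With \<open>a\<close> of norm \<open>- 1\<close>, the vectors \<open>u\<close> and
  \<open>v\<close> built from four orthonormal vectors span a totally isotropic line
  \<open>?L\<close>. The wedge of their functionals has radical \<open>orth \<eta> ?L\<close>, which
  contains \<open>?L\<close>.\<close>

lemma ex_cone_form:
  assumes "4 \<le> CARD('n)"
  shows "\<exists>\<phi>. alternating_form \<phi> \<and> vec.dim (radical \<phi>) + 2 = CARD('n) \<and>
    vec.dim (radical_on (radical \<phi>) \<eta>) = 2"
proof -
  obtain b where on: "\<And>i j. i < CARD('n) \<Longrightarrow> j < CARD('n) \<Longrightarrow> \<eta> (b i) (b j) = (if i = j then 1 else 0)"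
    by (rule ex_orthonormal_basis) blast
  have "(- 1 :: 'k) ^ q = - 1" by simp
  then obtain a :: 'k where "a ^ (q + 1) = - 1"
    using norm_surj by blast
  then have a: "a * a ^ q = - 1" "a ^ q * a = - 1" by (simp_all add: mult.commute)
  define u v where "u = b 0 + a *s b 1" and "v = b 2 + a *s b 3"
  have form: "\<eta> u u = 0" "\<eta> v v = 0" "\<eta> u v = 0" "\<eta> v u = 0"
    and coord: "\<eta> u (b 0) = 1" "\<eta> u (b 2) = 0" "\<eta> v (b 2) = 1"
    using assms a by (simp_all add: u_def v_def on)
  have "u \<noteq> 0"
    using coord(1) by auto
  have v: "v \<notin> vec.span {u}"
    using coord by (auto simp: in_span_singleton)
  let ?L = "vec.span {u, v}"
  define \<phi> where "\<phi> = (\<lambda>x y. \<eta> x u * \<eta> y v - \<eta> x v * \<eta> y u)"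
  have "alternating_form \<phi>"
    unfolding \<phi>_def by (rule alternating_form_eta_wedge)
  moreover have rad: "radical \<phi> = orth \<eta> ?L"
  proof
    show "orth \<eta> ?L \<subseteq> radical \<phi>"
      unfolding orth_span by (auto simp: radical_on_def \<phi>_def mem_orth)
    show "radical \<phi> \<subseteq> orth \<eta> ?L"
    proof
      fix x assume x: "x \<in> radical \<phi>"
      \<comment> \<open>With conjugated coefficients this combination represents
        \<open>\<phi> x\<close>; independence of \<open>u\<close> and \<open>v\<close> then kills
        both coefficients.\<close>
      have "\<eta> ((\<eta> x u ^ q) *s v - (\<eta> x v ^ q) *s u) y = 0" for y
      proof -
        have "\<phi> x y = 0"
          using x by (simp add: radical_on_def)
        then have "\<eta> y ((\<eta> x u ^ q) *s v - (\<eta> x v ^ q) *s u) = 0"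
          by (simp add: \<phi>_def)
        then show ?thesis
          using sym_zero by blast
      qed
      then have eq: "(\<eta> x u ^ q) *s v - (\<eta> x v ^ q) *s u = 0"
        using nondegD by blast
      have "\<eta> x u ^ q = 0"
        using arg_cong[OF eq, of "\<lambda>z. \<eta> z (b 2)"] coord by simp
      moreover have "\<eta> x v ^ q = 0"
        using eq calculation \<open>u \<noteq> 0\<close> by (simp add: vec.scale_eq_0_iff)
      ultimately show "x \<in> orth \<eta> ?L"
        unfolding orth_span by (simp add: mem_orth)
    qed
  qed
  moreover have dimL: "vec.dim ?L = 2"
    using \<open>u \<noteq> 0\<close> v by (simp only: dim_span_pair if_False)
  moreover have "?L \<subseteq> orth \<eta> ?L"
    using form unfolding orth_span by (auto simp: mem_orth in_span_pair)
  then have "radical_on (radical \<phi>) \<eta> = ?L"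
    unfolding rad radical_on_eq orth_orth[OF vec.subspace_span] by blast
  ultimately show ?thesis
    using dim_orth[OF vec.subspace_span, of "{u, v}"] by (intro exI[of _ \<phi>]) auto
qed

end

section \<open>Commuting polarities and the weight equation\<close>

context alternating_hermitian
begin

text \<open>The polar of \<open>u\<close> under \<open>\<phi>\<close> is the polar of
  \<open>adj u\<close> under \<open>\<eta>\<close>, so commuting says that the line of
  \<open>adj u\<close> is the preimage under \<open>adj\<close> of the line of \<open>u\<close>.
  Then every vector is an eigenvector of the square of \<open>adj\<close>.\<close>

lemma permutable_iff_scalar:
  "nondegenerate \<phi> \<and> permutable \<phi> \<eta> \<longleftrightarrow> (\<exists>c. c \<noteq> 0 \<and> (\<forall>u. adj (adj u) = c *s u))"
proof -
  have "orth \<phi> (vec.span {u}) = orth \<eta> (vec.span {adj u})" for u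
  proof -
    have iff: "y \<in> orth \<phi> (vec.span {u}) \<longleftrightarrow> \<phi> y u = 0" for y
    proof
      show "y \<in> orth \<phi> (vec.span {u}) \<Longrightarrow> \<phi> y u = 0"
        using phi_swap[of y u] vec.span_base[of u "{u}"] by (simp add: orth_def)
      show "\<phi> y u = 0 \<Longrightarrow> y \<in> orth \<phi> (vec.span {u})"
        using phi_swap[of y u] by (auto simp: orth_def in_span_singleton)
    qed
    have iff': "y \<in> orth \<eta> (vec.span {adj u}) \<longleftrightarrow> \<eta> y (adj u) = 0" for y
      unfolding orth_span by (simp add: mem_orth)
    show ?thesis
      by (rule set_eqI) (simp only: iff iff' phi_eq)
  qed
  then have 1: "orth \<eta> (orth \<phi> (vec.span {u})) = vec.span {adj u}" for u
    by (simp add: orth_orth)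
  have 2: "orth \<phi> (orth \<eta> (vec.span {u})) = {y. adj y \<in> vec.span {u}}" for u
  proof -
    have "orth \<phi> (orth \<eta> (vec.span {u})) = {y. adj y \<in> orth \<eta> (orth \<eta> (vec.span {u}))}"
      by (simp add: orth_def[of \<phi>] orth_def[of \<eta> "orth \<eta> (vec.span {u})"] phi_eq)
    then show ?thesis
      by (simp add: orth_orth)
  qed
  have perm: "permutable \<phi> \<eta> \<longleftrightarrow> (\<forall>u. u \<noteq> 0 \<longrightarrow> vec.span {adj u} = {y. adj y \<in> vec.span {u}})"
    unfolding permutable_def 1 2 ..
  show ?thesis
  proof
    assume "nondegenerate \<phi> \<and> permutable \<phi> \<eta>"
    then have nondeg: "adj u = 0 \<Longrightarrow> u = 0" and pointwise: "\<exists>c. adj (adj u) = c *s u" for u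
    proof -
      assume *: "nondegenerate \<phi> \<and> permutable \<phi> \<eta>"
      show "adj u = 0 \<Longrightarrow> u = 0"
        using * radical_phi by (auto simp: nondegenerate_def)
      show "\<exists>c. adj (adj u) = c *s u"
      proof (cases "u = 0")
        case False
        then have "adj u \<in> {y. adj y \<in> vec.span {u}}"
          using * vec.span_base[of "adj u" "{adj u}"] unfolding perm by auto
        then show ?thesis
          by (simp add: in_span_singleton)
      qed auto
    qed
    obtain u :: "'k ^ 'n" where u: "u \<noteq> 0"
      using ex_form_eq_1 by (metis zero_left zero_neq_one)
    obtain c where c: "adj (adj u) = c *s u"
      using pointwise by blast
    have "adj (adj v) = c *s v" for v
    proof (cases "v \<in> vec.span {u}")
      case True
      then obtain a where "v = a *s u"
        by (auto simp: in_span_singleton)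
      with c show ?thesis
        by (simp add: adj_scale mult.commute)
    next
      case False
      \<comment> \<open>Comparing the eigenvalues at \<open>u\<close>, \<open>v\<close> and
        \<open>u + v\<close> shows that one scalar serves all vectors.\<close>
      obtain d e where d: "adj (adj v) = d *s v" and e: "adj (adj (u + v)) = e *s (u + v)"
        using pointwise by metis
      have "e *s (u + v) = c *s u + d *s v"
        using e by (simp only: adj_add c d)
      then have eq: "(d - e) *s v = (e - c) *s u"
        by (simp add: vec.scale_left_diff_distrib vec.scale_right_distrib algebra_simps)
      have "d - e = 0"
      proof (rule ccontr)
        assume "d - e \<noteq> 0"
        then have "v = (inverse (d - e) * (e - c)) *s u"
          using arg_cong[OF eq, of "\<lambda>z. inverse (d - e) *s z"] by (simp only: vec.scale_scale) simp
        then show False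
          using False by (metis in_span_singleton)
      qed
      with eq u have "e - c = 0"
        by (metis vec.scale_eq_0_iff vec.scale_zero_left)
      with \<open>d - e = 0\<close> d show ?thesis by simp
    qed
    moreover have "c \<noteq> 0"
      using c u nondeg by (metis vec.scale_zero_left)
    ultimately show "\<exists>c. c \<noteq> 0 \<and> (\<forall>u. adj (adj u) = c *s u)" by blast
  next
    assume "\<exists>c. c \<noteq> 0 \<and> (\<forall>u. adj (adj u) = c *s u)"
    then obtain c where c: "c \<noteq> 0" "\<And>u. adj (adj u) = c *s u" by blast
    have "nondegenerate \<phi>"
      using radical_scalar[OF c(2,1)] by (simp add: nondegenerate_def)
    moreover have "vec.span {adj u} = {y. adj y \<in> vec.span {u}}" for u
    proof
      show "vec.span {adj u} \<subseteq> {y. adj y \<in> vec.span {u}}"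
        by (auto simp: in_span_singleton adj_scale c(2))
      show "{y. adj y \<in> vec.span {u}} \<subseteq> vec.span {adj u}"
      proof
        fix y assume "y \<in> {y. adj y \<in> vec.span {u}}"
        then obtain a where "adj y = a *s u"
          by (auto simp: in_span_singleton)
        then have eq: "c *s y = a ^ q *s adj u"
          by (metis c(2) adj_scale)
        have "y = inverse c *s (c *s y)"
          using c(1) by simp
        then have "y = (inverse c * a ^ q) *s adj u"
          unfolding eq by simp
        then show "y \<in> vec.span {adj u}"
          by (metis in_span_singleton)
      qed
    qed
    ultimately show "nondegenerate \<phi> \<and> permutable \<phi> \<eta>"
      unfolding perm by blast
  qed
qed

text \<open>The counts of \<open>phi_pairs\<close> by first vector and by line are equated.\<close>

lemma weight_equation:
  assumes "point_representatives \<omega>s (line_hermitian_grassmannian \<eta>)" "CARD('n) = k + 2" "even k"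
  shows "int (hamming_weight (codeword \<omega>s \<phi>)) * (int q * ((int q ^ 4 - 1) * (int q ^ 4 - int q ^ 2))) =
    (int q ^ 2 - 1) * (int q ^ (2 * k) * (int (card (isotropics UNIV)) - int (card eigs)) + int q ^ (k + 1) * int (card noniso_images))"
proof -
  have "1 \<le> q ^ 4" "q ^ 2 \<le> q ^ 4"
    using q_gt_1 by (auto intro: power_increasing)
  then have "int (card phi_pairs) = int (hamming_weight (codeword \<omega>s \<phi>)) * ((int q ^ 4 - 1) * (int q ^ 4 - int q ^ 2))"
    using card_phi_pairs_eq_weight[OF assms(1)] by (simp add: of_nat_diff)
  then show ?thesis
    using card_phi_pairs[OF assms(2,3)] by (simp add: mult.left_commute)
qed

end

section \<open>From extremal counts to minimum weight codewords\<close>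

context hermitian_space
begin

text \<open>The count of \<open>noniso_images\<close> can only increase the weight, so a class
  \<open>T\<close> on which it is zero and \<open>eigs\<close> is largest gives exactly the minimum
  words. Here \<open>X\<close> is \<open>q\<close> times that largest size, and its bound makes the
  words of \<open>T\<close> nonzero.\<close>

lemma min_weight_codewords_eq:
  assumes reps: "point_representatives \<omega>s (line_hermitian_grassmannian \<eta>)"
    and k: "CARD('n) = k + 2" "even k"
    and ex: "\<exists>\<phi>. alternating_form \<phi> \<and> T \<phi>"
    and T: "\<And>\<phi>. alternating_form \<phi> \<Longrightarrow> T \<phi> \<Longrightarrow>
      int q * int (card (alternating_hermitian.eigs \<eta> \<phi>)) = X \<and> alternating_hermitian.noniso_images \<eta> \<phi> = {}"
    and not_T: "\<And>\<phi> x y. alternating_form \<phi> \<Longrightarrow> \<not> T \<phi> \<Longrightarrow> \<phi> x y \<noteq> 0 \<Longrightarrow>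
      int q * int (card (alternating_hermitian.eigs \<eta> \<phi>)) < X"
    and X: "X < int q * int (card (isotropics UNIV))"
  shows "min_weight_codewords (grassmann_code \<omega>s) = {codeword \<omega>s \<phi> |\<phi>. alternating_form \<phi> \<and> T \<phi>}"
proof -
  let ?wt = "\<lambda>\<phi>. hamming_weight (codeword \<omega>s \<phi>)"
  let ?A = "int q * (int q * ((int q ^ 4 - 1) * (int q ^ 4 - int q ^ 2)))"
  let ?W = "(int q ^ 2 - 1) * (int q ^ (2 * k) * (int q * int (card (isotropics UNIV)) - X))"
  have "int q ^ 2 < int q ^ 4" "1 < int q ^ 4" "1 < int q ^ 2"
    using q_gt_1 by (auto intro: power_strict_increasing)
  then have A: "0 < ?A" and B: "0 < int q ^ 2 - 1" and W: "0 < ?W"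
    using q_gt_1 X by simp_all
  have wt: "int (?wt \<phi>) * ?A = (int q ^ 2 - 1) * (int q ^ (2 * k) *
      (int q * int (card (isotropics UNIV)) - int q * int (card (alternating_hermitian.eigs \<eta> \<phi>)))
      + int q ^ (k + 2) * int (card (alternating_hermitian.noniso_images \<eta> \<phi>)))"
    if "alternating_form \<phi>" for \<phi>
  proof -
    interpret alternating_hermitian q \<eta> \<phi>
      by unfold_locales (rule that)
    show ?thesis
      using arg_cong[OF weight_equation[OF reps k], of "\<lambda>z. int q * z"] by (simp add: algebra_simps)
  qed
  have wt_T: "int (?wt \<phi>) * ?A = ?W" if "alternating_form \<phi>" "T \<phi>" for \<phi>
    using wt[OF that(1)] T[OF that] by simp
  have wt_not_T: "?W < int (?wt \<phi>) * ?A"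
    if "alternating_form \<phi>" "\<not> T \<phi>" "\<phi> x y \<noteq> 0" for \<phi> x y
  proof -
    have "int q ^ (2 * k) * (int q * int (card (isotropics UNIV)) - X) <
      int q ^ (2 * k) * (int q * int (card (isotropics UNIV)) - int q * int (card (alternating_hermitian.eigs \<eta> \<phi>)))"
      using not_T[OF that] q_gt_1 by (intro mult_strict_left_mono) auto
    moreover have "0 \<le> int q ^ (k + 2) * int (card (alternating_hermitian.noniso_images \<eta> \<phi>))"
      by simp
    ultimately show ?thesis
      unfolding wt[OF that(1)] by (intro mult_strict_left_mono[OF _ B]) linarith
  qed
  \<comment> \<open>\<open>not_T\<close> concerns nonzero forms only; this shows that a word of
    nonzero weight comes from one.\<close>
  have wt_zero: "?wt \<phi> = 0" if "alternating_form \<phi>" "\<And>x y. \<phi> x y = 0" for \<phi>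
  proof -
    interpret alternating_hermitian q \<eta> \<phi>
      by unfold_locales (rule that)
    have "phi_pairs = {}"
      using that(2) by (auto simp: phi_pairs_def)
    moreover have "0 < q ^ 4 - 1" "0 < q ^ 4 - q ^ 2"
      using one_less_power[OF q_gt_1, of 4] power_strict_increasing[OF _ q_gt_1, of 2 4] by simp_all
    ultimately show ?thesis
      using card_phi_pairs_eq_weight[OF reps] by (metis card.empty mult_is_0 less_irrefl)
  qed
  obtain \<phi>0 where \<phi>0: "alternating_form \<phi>0" "T \<phi>0"
    using ex by blast
  have T_pos: "0 < ?wt \<phi>" if "alternating_form \<phi>" "T \<phi>" for \<phi>
    using wt_T[OF that] W A by (metis gr0I mult_zero_left of_nat_0 less_irrefl)
  have le: "?wt \<phi> \<le> ?wt \<psi>"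
    if asm: "alternating_form \<phi>" "T \<phi>" "alternating_form \<psi>" "?wt \<psi> \<noteq> 0" for \<phi> \<psi>
  proof -
    obtain x y where "\<psi> x y \<noteq> 0"
      using wt_zero[OF asm(3)] asm(4) by blast
    then have "int (?wt \<phi>) * ?A \<le> int (?wt \<psi>) * ?A"
      using wt_T[OF asm(1,2)] wt_T[OF asm(3)] wt_not_T[OF asm(3)] by (cases "T \<psi>") fastforce+
    then show ?thesis
      using A by (simp add: mult_le_cancel_right_pos)
  qed
  have less: "?wt \<phi>0 < ?wt \<psi>"
    if asm: "alternating_form \<psi>" "\<not> T \<psi>" "?wt \<psi> \<noteq> 0" for \<psi>
  proof -
    obtain x y where "\<psi> x y \<noteq> 0"
      using wt_zero[OF asm(1)] asm(3) by blast
    then have "int (?wt \<phi>0) * ?A < int (?wt \<psi>) * ?A"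
      using wt_T[OF \<phi>0] wt_not_T[OF asm(1,2)] by metis
    then show ?thesis
      using A by (simp add: mult_less_cancel_right_pos)
  qed
  let ?C = "grassmann_code \<omega>s"
  have code: "c \<in> ?C \<longleftrightarrow> (\<exists>\<phi>. c = codeword \<omega>s \<phi> \<and> alternating_form \<phi>)" for c
    unfolding grassmann_code_def by simp
  have mem: "c \<in> min_weight_codewords ?C \<longleftrightarrow> c \<in> ?C \<and> hamming_weight c \<noteq> 0 \<and>
      (\<forall>c'\<in>?C. hamming_weight c' \<noteq> 0 \<longrightarrow> hamming_weight c \<le> hamming_weight c')" for c
    unfolding min_weight_codewords_def is_arg_min_def mem_Collect_eq hamming_weight_eq_0
    by (meson not_less)
  show ?thesis
  proof (intro set_eqI iffI)
    fix c assume c: "c \<in> min_weight_codewords ?C"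
    then obtain \<phi> where \<phi>: "c = codeword \<omega>s \<phi>" "alternating_form \<phi>"
      unfolding mem code by (elim conjE exE)
    have nonzero: "?wt \<phi> \<noteq> 0"
      using c unfolding mem \<phi>(1) by (elim conjE)
    have "codeword \<omega>s \<phi>0 \<in> ?C"
      unfolding code using \<phi>0(1) by blast
    then have "?wt \<phi> \<le> ?wt \<phi>0"
      using c T_pos[OF \<phi>0] unfolding mem \<phi>(1) by simp
    then have "T \<phi>"
      using less[OF \<phi>(2) _ nonzero] by (meson not_less)
    with \<phi> show "c \<in> {codeword \<omega>s \<phi> |\<phi>. alternating_form \<phi> \<and> T \<phi>}" by blast
  next
    fix c assume "c \<in> {codeword \<omega>s \<phi> |\<phi>. alternating_form \<phi> \<and> T \<phi>}"
    then obtain \<phi> where \<phi>: "c = codeword \<omega>s \<phi>" "alternating_form \<phi>" "T \<phi>"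
      unfolding mem_Collect_eq by (elim exE conjE)
    show "c \<in> min_weight_codewords ?C"
      unfolding mem
    proof (intro conjI ballI impI)
      show "c \<in> ?C"
        unfolding code using \<phi>(1,2) by blast
      show "hamming_weight c \<noteq> 0"
        unfolding \<phi>(1) using T_pos[OF \<phi>(2,3)] by simp
      fix c' assume "c' \<in> ?C" "hamming_weight c' \<noteq> 0"
      then show "hamming_weight c \<le> hamming_weight c'"
        unfolding code using le[OF \<phi>(2,3)] \<phi>(1) by auto
    qed
  qed
qed

lemma card_isotropics_UNIV:
  assumes "even (CARD('n))"
  shows "int q * int (card (isotropics UNIV)) = int q ^ (2 * CARD('n)) + int q ^ CARD('n) * (int q - 1)"
proof -
  have "radical \<eta> = {0}"
    using nondeg by (simp add: nondegenerate_def)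
  then show ?thesis
    using card_isotropics[OF vec.subspace_UNIV] assms by (simp add: card_cart_basis)
qed

lemma min_weight_codewords_small:
  assumes reps: "point_representatives \<omega>s (line_hermitian_grassmannian \<eta>)"
    and m: "CARD('n) = 4 \<or> CARD('n) = 6"
  shows "min_weight_codewords (grassmann_code \<omega>s) =
    {codeword \<omega>s \<phi> |\<phi>. alternating_form \<phi> \<and> nondegenerate \<phi> \<and> permutable \<phi> \<eta>}"
proof -
  obtain k where k: "CARD('n) = k + 2" "k = 2 \<or> k = 4"
    using m by (intro that[of "CARD('n) - 2"]) auto
  then have "even k" by auto
  let ?X = "int q * (1 + (int q + 1) * (int q ^ (k + 2) - 1))"
  have iff: "nondegenerate \<phi> \<and> permutable \<phi> \<eta> \<longleftrightarrow>
      (\<exists>c. c \<noteq> 0 \<and> (\<forall>u. alternating_hermitian.adj \<eta> \<phi> (alternating_hermitian.adj \<eta> \<phi> u) = c *s u))"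
    if "alternating_form \<phi>" for \<phi>
  proof -
    interpret alternating_hermitian q \<eta> \<phi>
      by unfold_locales (rule that)
    show ?thesis by (rule permutable_iff_scalar)
  qed
  show ?thesis
  proof (rule min_weight_codewords_eq[OF reps k(1) \<open>even k\<close>, where X = ?X])
    show "\<exists>\<phi>. alternating_form \<phi> \<and> nondegenerate \<phi> \<and> permutable \<phi> \<eta>"
      using ex_scalar_alternating_form m iff by (metis even_numeral)
  next
    fix \<phi> assume \<phi>: "alternating_form \<phi>" "nondegenerate \<phi> \<and> permutable \<phi> \<eta>"
    interpret alternating_hermitian q \<eta> \<phi>
      by unfold_locales (rule \<phi>)
    obtain c where c: "c \<noteq> 0" "\<And>u. adj (adj u) = c *s u"
      using iff \<phi> by blast
    show "int q * int (card eigs) = ?X \<and> noniso_images = {}"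
      using card_eigs_scalar[OF c(2,1)] noniso_images_scalar[OF c(2,1)] k(1) by simp
  next
    fix \<phi> x y assume \<phi>: "alternating_form \<phi>" "\<not> (nondegenerate \<phi> \<and> permutable \<phi> \<eta>)" "\<phi> x y \<noteq> 0"
    interpret alternating_hermitian q \<eta> \<phi>
      by unfold_locales (rule \<phi>)
    obtain r where r: "2 \<le> r" "vec.dim (radical \<phi>) + r = CARD('n)"
      using rank_ge_2[OF \<phi>(3)] .
    show "int q * int (card eigs) < ?X"
      using card_eigs_less_small[OF k r(2,1)] iff[OF \<phi>(1)] \<phi>(2) q_gt_1 by auto
  next
    \<comment> \<open>It remains to see that \<open>eigs\<close> does not exhaust the isotropic
      vectors, so that the common weight is positive.\<close>
    have "int q ^ 2 \<le> int q ^ k" "0 < int q ^ (k + 4)" "int q ^ (k + 2) < int q ^ (k + 4)"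
      using k(2) q_gt_1 by (auto intro!: power_increasing power_strict_increasing simp del: power_Suc)
    moreover have "4 \<le> int q ^ 2"
      using q_gt_1 mult_mono[of 2 "int q" 2 "int q"] by (simp add: power2_eq_square)
    ultimately have "4 * int q ^ (k + 4) \<le> int q ^ k * int q ^ (k + 4)"
      by (intro mult_right_mono) auto
    also have "\<dots> = int q ^ (2 * (k + 2))"
    proof -
      have "2 * (k + 2) = k + (k + 4)" by simp
      then show ?thesis by (metis power_add)
    qed
    finally have le: "4 * int q ^ (k + 4) \<le> int q ^ (2 * (k + 2))" .
    have eq: "int q ^ (k + 2) * (int q - 1) = int q ^ (k + 3) - int q ^ (k + 2)"
      by (simp add: power_add power2_eq_square power3_eq_cube algebra_simps)
    have "?X = int q ^ (k + 4) + int q ^ (k + 3) - int q ^ 2"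
      by (simp add: power_add power2_eq_square power3_eq_cube power4_eq_xxxx algebra_simps)
    also have "\<dots> < int q ^ (2 * (k + 2)) + int q ^ (k + 2) * (int q - 1)"
      unfolding eq using le \<open>0 < int q ^ (k + 4)\<close> \<open>int q ^ (k + 2) < int q ^ (k + 4)\<close> zero_le_power2[of "int q"]
      by linarith
    also have "\<dots> = int q * int (card (isotropics UNIV))"
      using card_isotropics_UNIV \<open>even k\<close> unfolding k(1) by simp
    finally show "?X < int q * int (card (isotropics UNIV))" .
  qed
qed

lemma min_weight_codewords_large:
  assumes reps: "point_representatives \<omega>s (line_hermitian_grassmannian \<eta>)"
    and k: "CARD('n) = k + 2" "even k" "6 \<le> k"
  shows "min_weight_codewords (grassmann_code \<omega>s) =
    {codeword \<omega>s \<phi> |\<phi>. alternating_form \<phi> \<and> vec.dim (radical \<phi>) = k \<and> vec.dim (radical_on (radical \<phi>) \<eta>) = 2}"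
proof (rule min_weight_codewords_eq[OF reps k(1,2), where X = "int q ^ (2 * k) + int q ^ (k + 2) * (int q - 1)"])
  show "\<exists>\<phi>. alternating_form \<phi> \<and> vec.dim (radical \<phi>) = k \<and> vec.dim (radical_on (radical \<phi>) \<eta>) = 2"
    using ex_cone_form k by auto
next
  fix \<phi> assume \<phi>: "alternating_form \<phi>" "vec.dim (radical \<phi>) = k \<and> vec.dim (radical_on (radical \<phi>) \<eta>) = 2"
  interpret alternating_hermitian q \<eta> \<phi>
    by unfold_locales (rule \<phi>)
  have "vec.dim (radical \<phi>) + 2 = CARD('n)"
    using \<phi> k by simp
  note cone = this \<phi>(2)[THEN conjunct2]
  show "int q * int (card eigs) = int q ^ (2 * k) + int q ^ (k + 2) * (int q - 1) \<and> noniso_images = {}"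
    using card_eigs_cone[OF cone] noniso_images_cone[OF cone] \<phi>(2) k by simp
next
  fix \<phi> x y
  assume \<phi>: "alternating_form \<phi>" "\<not> (vec.dim (radical \<phi>) = k \<and> vec.dim (radical_on (radical \<phi>) \<eta>) = 2)"
    "\<phi> x y \<noteq> 0"
  interpret alternating_hermitian q \<eta> \<phi>
    by unfold_locales (rule \<phi>)
  obtain r where r: "2 \<le> r" "vec.dim (radical \<phi>) + r = CARD('n)"
    using rank_ge_2[OF \<phi>(3)] .
  show "int q * int (card eigs) < int q ^ (2 * k) + int q ^ (k + 2) * (int q - 1)"
    using \<phi>(2) r k by (intro card_eigs_less_large[OF k r(2,1)]) auto
next
  have "int q ^ (2 * k) < int q ^ (2 * (k + 2))"
    using q_gt_1 by (intro power_strict_increasing) auto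
  then show "int q ^ (2 * k) + int q ^ (k + 2) * (int q - 1) < int q * int (card (isotropics UNIV))"
    using card_isotropics_UNIV k(2) unfolding k(1) by simp
qed

end

theorem corollary3p15:
  fixes q m :: nat
    and \<eta> :: "'k::{field, finite} ^ 'n::finite \<Rightarrow> 'k ^ 'n \<Rightarrow> 'k"
    and \<omega>s :: "('k, 'n) ext2 list"
  assumes "primepow q" and "CARD('k) = q ^ 2"
    and "CARD('n) = m" and "m \<ge> 4" and "even m"
    and "hermitian_form q \<eta>" and "nondegenerate \<eta>"
    and "point_representatives \<omega>s (line_hermitian_grassmannian \<eta>)"
  shows "(m = 4 \<or> m = 6 \<longrightarrow>
            min_weight_codewords (grassmann_code \<omega>s) =
              {codeword \<omega>s \<phi> |\<phi>. alternating_form \<phi> \<and> nondegenerate \<phi> \<and> permutable \<phi> \<eta>}) \<and>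
         (m > 6 \<longrightarrow>
            min_weight_codewords (grassmann_code \<omega>s) =
              {codeword \<omega>s \<phi> |\<phi>. alternating_form \<phi> \<and> vec.dim (radical \<phi>) = m - 2 \<and>
                 meets_in_cone \<eta> (radical \<phi>) 2 (m - 4)})"
proof -
  interpret hermitian_space q \<eta>
    by unfold_locales fact+
  have "min_weight_codewords (grassmann_code \<omega>s) =
      {codeword \<omega>s \<phi> |\<phi>. alternating_form \<phi> \<and> vec.dim (radical \<phi>) = m - 2 \<and>
        meets_in_cone \<eta> (radical \<phi>) 2 (m - 4)}" if "m > 6"
  proof -
    \<comment> \<open>By parity \<open>m\<close> is at least 8, as \<open>6 \<le> k\<close> demands
      for \<open>k = m - 2\<close>.\<close>
    have "m \<noteq> 7"
      using \<open>even m\<close> by auto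
    then have "CARD('n) = (m - 2) + 2" "even (m - 2)" "6 \<le> m - 2"
      using assms(3,5) that by auto
    note eq = min_weight_codewords_large[OF assms(8) this]
    have "vec.dim (radical \<phi>) = m - 2 \<and> meets_in_cone \<eta> (radical \<phi>) 2 (m - 4) \<longleftrightarrow>
        vec.dim (radical \<phi>) = m - 2 \<and> vec.dim (radical_on (radical \<phi>) \<eta>) = 2" for \<phi>
      using that by (auto simp: meets_in_cone_def)
    then show ?thesis
      unfolding eq by simp
  qed
  then show ?thesis
    using min_weight_codewords_small[OF assms(8)] assms(3) by blast
qed

end
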